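(* Let $n\ge1$, let $\alpha_1,\dots,\alpha_n\in[1/2,1]$, and let $X_1,\dots,X_n$ be independent real-valued random variables satisfying $\mathcal{Q}_2(X_i)\le\alpha_i$ for each $i$. Put $\lambda=\sum_{i=1}^n(1-\alpha_i)$ and let $\eta_1,\eta_2$ be independent Poisson random variables, each with mean $\lambda$. Then $$\mathcal{Q}_2(X_1+\cdots+X_n)\le\mathbb{P}(\eta_1-\eta_2\in\{0,1\})\le\sqrt{\frac{2}{\pi\lambda}},$$ where for $\lambda=0$ the Poisson variables are identically $0$ and the right-most expression is read as $+\infty$.
   Context: For a real-valued random variable $X$ and $h>0$, the concentration function is $\mathcal{Q}_h(X)=\sup_{x\in\mathbb{R}}\mathbb{P}(X\in(x,x+h])$. *)

theory Defs
  imports "HOL-Probability.Probability"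
begin

definition concentration :: "'a measure \<Rightarrow> real \<Rightarrow> ('a \<Rightarrow> real) \<Rightarrow> real" where
  "concentration M h X = (SUP x. measure M {\<omega> \<in> space M. X \<omega> \<in> {x<..x + h}})"

text \<open>The library's \<^const>\<open>poisson_pmf\<close> is specified only for a positive rate; a Poisson
  variable of mean 0 is identically 0.\<close>

definition poisson0_pmf :: "real \<Rightarrow> nat pmf" where
  "poisson0_pmf r = (if r = 0 then return_pmf 0 else poisson_pmf r)"

definition poisson_distributed :: "'a measure \<Rightarrow> real \<Rightarrow> ('a \<Rightarrow> nat) \<Rightarrow> bool" where
  "poisson_distributed N r \<eta> \<longleftrightarrow>
     \<eta> \<in> measurable N (count_space UNIV) \<and>
     distr N (count_space UNIV) \<eta> = measure_pmf (poisson0_pmf r)"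

end

theory Submission
  imports Defs
begin

text \<open>
  The bound \<open>Q\<^sub>2(X\<^sub>i) \<le> \<alpha>\<^sub>i\<close> forces the mass of \<open>X\<^sub>i\<close>, apart from a part of weight
  \<open>2 \<alpha>\<^sub>i - 1\<close>, to split into pairs of equally likely points at distance at least 2, so \<open>X\<^sub>i\<close>
  behaves like a lazy random sign that moves with probability \<open>p\<^sub>i = 2 (1 - \<alpha>\<^sub>i)\<close>. Kleitman's
  induction over families of disjoint intervals then shows that the sum is no more concentrated
  than the sum of the lazy signs on \<open>{0, 1}\<close>, a probability equal to
  \<open>1/pi\<close> times the integral over \<open>[0, pi]\<close> of \<open>(1 + cos t) * (\<Prod>i. 1 - p\<^sub>i * (1 - cos t))\<close>.
  For the Poisson difference the product is replaced by its exponential majorant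
  \<open>exp (- 2 \<lambda> (1 - cos t))\<close>. The pointwise comparison fails near \<open>t = pi\<close> once two of the
  \<open>p\<^sub>i\<close> exceed 1/2. Folding \<open>t\<close> onto \<open>pi - t\<close>, the loss there is absorbed by the second-order
  gain near \<open>t = 0\<close>: means reduce to \<open>m\<close> equal parameters, integration by parts makes gain and
  loss comparable, and a single-crossing argument reduces all \<open>m \<ge> 3\<close> to \<open>m = 3\<close>.
\<close>

section \<open>Powers of cosine and polynomial integrals\<close>

fun wallis :: "nat \<Rightarrow> real" where
  "wallis 0 = pi / 2"
| "wallis (Suc 0) = 1"
| "wallis (Suc (Suc k)) = (real k + 1) / (real k + 2) * wallis k"

text \<open>Wallis reduction: \<open>cos t ^ (k+1) * sin t\<close> vanishes at both ends of the
  interval, and its derivative is a combination of \<open>cos t ^ (k+2)\<close> and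
  \<open>cos t ^ k\<close> alone.\<close>

lemma has_integral_cos_power: "((\<lambda>t. cos t ^ k) has_integral wallis k) {0..pi/2}"
proof (induction k rule: wallis.induct)
  case 1
  show ?case using has_integral_const_real[of "1::real" 0 "pi/2"] by simp
next
  case 2
  have "((\<lambda>t. cos t) has_integral (sin (pi/2) - sin 0)) {0..pi/2}"
    by (rule fundamental_theorem_of_calculus)
       (auto intro!: derivative_eq_intros simp flip: has_real_derivative_iff_has_vector_derivative)
  then show ?case by simp
next
  case (3 k)
  have "((\<lambda>t. (real k + 2) * cos t ^ (k+2) - (real k + 1) * cos t ^ k) has_integral
     (cos (pi/2) ^ (k+1) * sin (pi/2) - cos 0 ^ (k+1) * sin 0)) {0..pi/2}"
  proof (rule fundamental_theorem_of_calculus)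
    fix t :: real assume "t \<in> {0..pi/2}"
    have "((\<lambda>t. cos t ^ (k+1) * sin t) has_real_derivative
        (real k + 2) * cos t ^ (k+2) - (real k + 1) * cos t ^ k) (at t within {0..pi/2})"
    proof (rule DERIV_cong)
      show "((\<lambda>t. cos t ^ (k+1) * sin t) has_real_derivative
         (1 + real k) * (cos t ^ k * (- sin t)) * sin t + cos t * cos t ^ (k+1)) (at t within {0..pi/2})"
        unfolding Suc_eq_plus1[symmetric]
        by (rule DERIV_mult[OF DERIV_power_Suc[OF DERIV_subset[OF DERIV_cos]] DERIV_subset[OF DERIV_sin], THEN DERIV_cong]) (simp_all add: algebra_simps)
      have ss: "sin t * sin t = 1 - cos t * cos t"
        using sin_cos_squared_add[of t] by (simp add: power2_eq_square)
      have "(1 + real k) * (cos t ^ k * (- sin t)) * sin t + cos t * cos t ^ (k+1)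
           = - ((1 + real k) * cos t ^ k * (sin t * sin t)) + cos t * cos t * cos t ^ k"
        by simp
      also have "\<dots> = (real k + 2) * cos t ^ (k+2) - (real k + 1) * cos t ^ k"
        unfolding ss by (simp add: algebra_simps)
      finally show "(1 + real k) * (cos t ^ k * (- sin t)) * sin t + cos t * cos t ^ (k+1)
           = (real k + 2) * cos t ^ (k+2) - (real k + 1) * cos t ^ k" .
    qed
    then show "((\<lambda>t. cos t ^ (k+1) * sin t) has_vector_derivative
        (real k + 2) * cos t ^ (k+2) - (real k + 1) * cos t ^ k) (at t within {0..pi/2})"
      by (simp add: has_real_derivative_iff_has_vector_derivative)
  qed simp
  then have "((\<lambda>t. (real k + 2) * cos t ^ (k+2) - (real k + 1) * cos t ^ k) has_integral 0) {0..pi/2}"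
    by simp
  from has_integral_add[OF this has_integral_mult_right[OF 3, of "real k + 1"]]
  have "((\<lambda>t. (real k + 2) * cos t ^ (k+2)) has_integral (real k + 1) * wallis k) {0..pi/2}"
    by simp
  note * = has_integral_mult_right[OF this, of "1 / (real k + 2)"]
  have "real k + 2 \<noteq> 0" by linarith
  then have "(\<lambda>t. 1 / (real k + 2) * ((real k + 2) * cos t ^ (k+2))) = (\<lambda>t. cos t ^ Suc (Suc k))"
    by (simp add: fun_eq_iff)
  moreover have "1 / (real k + 2) * ((real k + 1) * wallis k) = wallis (Suc (Suc k))"
    by simp
  ultimately show ?case using * by metis
qed

lemma has_integral_cos_poly:
  "((\<lambda>t. \<Sum>k<n. a k * cos t ^ k) has_integral (\<Sum>k<n. a k * wallis k)) {0..pi/2}"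
  by (intro has_integral_sum has_integral_mult_right has_integral_cos_power) auto

text \<open>Write \<open>x = p * (1 - cos t)\<close> and \<open>v = 1 - x\<close>. Integration by parts turns the lower bound
  \<open>m * v ^ (m - 1) * (x\<^sup>2 / 2 - x ^ 3 / 6)\<close> of \<open>exp (- m * x) - v ^ m\<close> into
  \<open>v ^ m\<close> times \<open>slope_poly p (cos t)\<close>. As a function of \<open>p\<close>, \<open>chord p c\<close> is the chord
  over \<open>[1/2, 1]\<close> of the convex function \<open>\<bar>1 - p * (1 + c)\<bar>\<close>.\<close>

definition slope_poly :: "real \<Rightarrow> real \<Rightarrow> real" where
  "slope_poly p c = p / 2 * ((1 + 2 * c) - p / 3 * (1 - c) * (2 + 3 * c))"

definition chord :: "real \<Rightarrow> real \<Rightarrow> real" where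
  "chord p c = (1 - p) + (3 * p - 2) * c"

text \<open>Integrated against \<open>1 - cos t\<close>, this weighs the lower bound for the gain
  near t = 0, after integration by parts, against the loss folded over from near t = pi. The
  integral has to reach the boundary term \<open>p/2*(1-p/3)*(1-p)^m\<close>.\<close>

definition gain :: "nat \<Rightarrow> real \<Rightarrow> real \<Rightarrow> real" where
  "gain m p c = (1 - p + p * c) ^ m * slope_poly p c - chord p c ^ m"

lemma sum_lessThan_7: "(\<Sum>k<(7::nat). f k) = f 0 + f 1 + f 2 + f 3 + f 4 + f 5 + (f 6 :: real)"
  by (simp add: eval_nat_numeral)

lemma wallis_values: "wallis 1 = 1" "wallis 2 = pi/4" "wallis 3 = 2/3" "wallis 4 = 3/16*pi"
  "wallis 5 = 8/15" "wallis 6 = 5/32*pi"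
  by (simp_all add: eval_nat_numeral)

section \<open>Three equal parameters\<close>

lemma has_integral_gain_3:
  "((\<lambda>t. (1 - cos t) * gain 3 p (cos t)) has_integral
     (61/3 - 13/2 * pi) + (51/2 * pi - 80) * p + (209/2 - 33 * pi) * p^2 + (431/32 * pi - 131/3) * p^3
      + (35/32 * pi - 17/6) * p^4 + (14/15 - 21/64 * pi) * p^5 + p/2*(1-p/3)*(1-p)^3) {0..pi/2}"
proof -
  \<comment> \<open>The entries are the coefficients of the powers of \<open>cos t\<close> from 0 to
    6 in the expanded integrand. In the value of the integral the boundary term is kept apart, ready
    to cancel in the next lemma.\<close>
  define a where "a = nth [-1 + 7/2*p - 29/6*p^2 + 7/2*p^3 - 3/2*p^4 + 1/3*p^5,
     7 - 47/2*p + 163/6*p^2 - 13*p^3 + 7/2*p^4 - 7/6*p^5,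
     -18 + 68*p - 491/6*p^2 + 30*p^3 + p^4 + 5/6*p^5,
     20 - 84*p + 227/2*p^2 - 43*p^3 - 9*p^4 + 5/3*p^5,
     -8 + 36*p - 54*p^2 + 45/2*p^3 + 17/2*p^4 - 10/3*p^5,
     -5/2*p^4 + 13/6*p^5, -1/2*p^5]"
  have a: "a 0 = -1 + 7/2*p - 29/6*p^2 + 7/2*p^3 - 3/2*p^4 + 1/3*p^5"
     "a 1 = 7 - 47/2*p + 163/6*p^2 - 13*p^3 + 7/2*p^4 - 7/6*p^5"
     "a 2 = -18 + 68*p - 491/6*p^2 + 30*p^3 + p^4 + 5/6*p^5"
     "a 3 = 20 - 84*p + 227/2*p^2 - 43*p^3 - 9*p^4 + 5/3*p^5"
     "a 4 = -8 + 36*p - 54*p^2 + 45/2*p^3 + 17/2*p^4 - 10/3*p^5"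
     "a 5 = -5/2*p^4 + 13/6*p^5" "a 6 = -1/2*p^5"
    by (simp_all add: a_def)
  have eq: "(1 - cos t) * gain 3 p (cos t) = (\<Sum>k<7. a k * cos t ^ k)" for t
    unfolding gain_def slope_poly_def chord_def a sum_lessThan_7
    by (simp add: field_simps eval_nat_numeral)
  have val: "(\<Sum>k<7. a k * wallis k) = (61/3 - 13/2 * pi) + (51/2 * pi - 80) * p + (209/2 - 33 * pi) * p^2 + (431/32 * pi - 131/3) * p^3
      + (35/32 * pi - 17/6) * p^4 + (14/15 - 21/64 * pi) * p^5 + p/2*(1-p/3)*(1-p)^3"
    unfolding a sum_lessThan_7 wallis_values wallis.simps
    by (simp add: field_simps eval_nat_numeral)
  show ?thesis
    unfolding eq val[symmetric] by (rule has_integral_cos_poly)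
qed

lemma gain_3_bound:
  assumes "1/2 \<le> p" "p \<le> 1"
  shows "p/2*(1-p/3)*(1-p)^3 \<le> integral {0..pi/2} (\<lambda>t. (1 - cos t) * gain 3 p (cos t))"
proof -
  \<comment> \<open>In the Bernstein basis of \<open>[1/2, 1]\<close> all coefficients are positive.\<close>
  define u w where "u = 2*p-1" "w = 2*(1-p)"
  \<comment> \<open>Here \<open>u + w = 1\<close>, so the quintic in \<open>p\<close> becomes
    homogeneous in \<open>u\<close> and \<open>w\<close>. Its tightest coefficient is that of
    \<open>u^5\<close>, about 0.003, which is the whole value at \<open>p = 1\<close>.\<close>
  have nn: "u \<ge> 0" "w \<ge> 0" using assms by (auto simp: u_w_def)
  have "0 \<le> (409/480 - 529/2048*pi) * w^5 + (237/1024*pi - 41/96) * (u*w^4) + (79/128*pi - 5/4) * (u^2*w^3)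
     + (35/24 - 17/64*pi) * (u^3*w^2) + (2/3 - 19/128*pi) * (u^4*w) + (15/64*pi - 11/15) * u^5"
    using pi_approx nn by (intro add_nonneg_nonneg mult_nonneg_nonneg zero_le_power) (auto simp: field_simps)
  also have "\<dots> = (61/3 - 13/2 * pi) + (51/2 * pi - 80) * p + (209/2 - 33 * pi) * p^2 + (431/32 * pi - 131/3) * p^3
      + (35/32 * pi - 17/6) * p^4 + (14/15 - 21/64 * pi) * p^5"
    unfolding u_w_def by algebra
  finally show ?thesis
    unfolding integral_unique[OF has_integral_gain_3] by simp
qed


section \<open>Two equal parameters\<close>

lemma has_integral_pair:
  "((\<lambda>t. (1 + cos t) * ((2*p*(1-cos t))^2/4 - (2*p*(1-cos t))^3/6 + (2*p*(1-cos t))^4/24 - (2*p*(1-cos t))^5/120)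
       - (1 - cos t) * (1 - p * (1 + cos t))^2) has_integral
     (1 - pi/2) + pi/2 * p - 2/3 * p^2 + (8/9 - 5/12*pi) * p^3 + (7/24*pi - 34/45) * p^4
       + (112/225 - 7/40*pi) * p^5) {0..pi/2}"
proof -
  define a where "a = nth [-1 + 2*p - 4/3*p^3 + 2/3*p^4 - 4/15*p^5, 1 - 2*p^2 + 8/3*p^3 - 2*p^4 + 16/15*p^5,
     -2*p + 4/3*p^4 - 4/3*p^5, 2*p^2 - 8/3*p^3 + 4/3*p^4, 4/3*p^3 - 2*p^4 + 4/3*p^5,
     2/3*p^4 - 16/15*p^5, 4/15*p^5]"
  have a: "a 0 = -1 + 2*p - 4/3*p^3 + 2/3*p^4 - 4/15*p^5"
     "a 1 = 1 - 2*p^2 + 8/3*p^3 - 2*p^4 + 16/15*p^5"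
     "a 2 = -2*p + 4/3*p^4 - 4/3*p^5" "a 3 = 2*p^2 - 8/3*p^3 + 4/3*p^4"
     "a 4 = 4/3*p^3 - 2*p^4 + 4/3*p^5"
     "a 5 = 2/3*p^4 - 16/15*p^5" "a 6 = 4/15*p^5"
    by (simp_all add: a_def)
  have eq: "(1 + cos t) * ((2*p*(1-cos t))^2/4 - (2*p*(1-cos t))^3/6 + (2*p*(1-cos t))^4/24 - (2*p*(1-cos t))^5/120)
       - (1 - cos t) * (1 - p * (1 + cos t))^2 = (\<Sum>k<7. a k * cos t ^ k)" for t
    unfolding a sum_lessThan_7
    by (simp add: field_simps eval_nat_numeral)
  have val: "(\<Sum>k<7. a k * wallis k) = (1 - pi/2) + pi/2 * p - 2/3 * p^2 + (8/9 - 5/12*pi) * p^3 + (7/24*pi - 34/45) * p^4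
       + (112/225 - 7/40*pi) * p^5"
    unfolding a sum_lessThan_7 wallis_values wallis.simps
    by (simp add: field_simps eval_nat_numeral)
  show ?thesis
    unfolding eq val[symmetric] by (rule has_integral_cos_poly)
qed

lemma exp_neg_taylor:
  fixes x :: real
  assumes "x \<ge> 0"
  shows "1 - x + x^2/2 - x^3/6 \<le> exp (-x)" "1 - x + x^2/2 - x^3/6 + x^4/24 - x^5/120 \<le> exp (-x)"
proof -
  \<comment> \<open>Each comparison below is obtained by integrating the previous one from 0,
    starting from \<open>1 - y \<le> exp (-y)\<close>.\<close>
  have P: "f 0 = 0 \<Longrightarrow> (\<And>y. y \<ge> 0 \<Longrightarrow> DERIV f y :> g y) \<Longrightarrow> (\<And>y. y \<ge> 0 \<Longrightarrow> 0 \<le> g y) \<Longrightarrow> y \<ge> 0 \<Longrightarrow> 0 \<le> f y"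
    for f g :: "real \<Rightarrow> real" and y
    using DERIV_nonneg_imp_nondecreasing[of 0 y f] by force
  have 1: "0 \<le> exp (-y) - (1 - y)" if "y \<ge> 0" for y :: real using exp_ge_add_one_self[of "-y"] by simp
  have 2: "0 \<le> 1 - y + y^2/2 - exp (-y)" if "y \<ge> 0" for y :: real
    by (rule P[where g = "\<lambda>y. exp (-y) - (1 - y)", OF _ _ 1 that]) (auto intro!: derivative_eq_intros simp: field_simps)
  have 3: "0 \<le> exp (-y) - (1 - y + y^2/2 - y^3/6)" if "y \<ge> 0" for y :: real
    by (rule P[where g = "\<lambda>y. 1 - y + y^2/2 - exp (-y)", OF _ _ 2 that]) (auto intro!: derivative_eq_intros simp: field_simps)
  have 4: "0 \<le> (1 - y + y^2/2 - y^3/6 + y^4/24) - exp (-y)" if "y \<ge> 0" for y :: real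
    by (rule P[where g = "\<lambda>y. exp (-y) - (1 - y + y^2/2 - y^3/6)", OF _ _ 3 that]) (auto intro!: derivative_eq_intros simp: field_simps)
  have 5: "0 \<le> exp (-y) - (1 - y + y^2/2 - y^3/6 + y^4/24 - y^5/120)" if "y \<ge> 0" for y :: real
    by (rule P[where g = "\<lambda>y. (1 - y + y^2/2 - y^3/6 + y^4/24) - exp (-y)", OF _ _ 4 that]) (auto intro!: derivative_eq_intros simp: field_simps)
  show "1 - x + x^2/2 - x^3/6 \<le> exp (-x)" "1 - x + x^2/2 - x^3/6 + x^4/24 - x^5/120 \<le> exp (-x)"
    using 3[OF assms] 5[OF assms] by simp_all
qed

text \<open>With \<open>x = 2 * p * (1 - cos t)\<close> the square is \<open>1 - x + x^2/4\<close>,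
  so the quintic Taylor bound for \<open>exp (-x)\<close> exceeds it by a polynomial starting with
  \<open>x^2/4\<close>. The loss is kept as an exact square instead of being replaced by a
  chord.\<close>

lemma fold_bound_pair:
  assumes "1/2 \<le> p" "p \<le> 1"
  shows "0 \<le> integral {0..pi/2} (\<lambda>t. (1 + cos t) * (exp (- (2 * p * (1 - cos t))) - (1 - p * (1 - cos t))^2)
       - (1 - cos t) * (1 - p * (1 + cos t))^2)"
proof -
  \<comment> \<open>In the Bernstein basis of \<open>[1/2, 1]\<close> all coefficients are positive.\<close>
  define u w where "u = 2*p-1" "w = 2*(1-p)"
  have nn: "u \<ge> 0" "w \<ge> 0" using assms by (auto simp: u_w_def)
  have "0 \<le> (1643/1800 - 1111/3840*pi) * w^5 + (1603/360 - 251/192*pi) * (u*w^4) + (157/18 - 39/16*pi) * (u^2*w^3)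
     + (779/90 - 115/48*pi) * (u^3*w^2) + (199/45 - 61/48*pi) * (u^4*w) + (217/225 - 3/10*pi) * u^5"
    using pi_approx nn by (intro add_nonneg_nonneg mult_nonneg_nonneg zero_le_power) (auto simp: field_simps)
  also have "\<dots> = (1 - pi/2) + pi/2 * p - 2/3 * p^2 + (8/9 - 5/12*pi) * p^3 + (7/24*pi - 34/45) * p^4
       + (112/225 - 7/40*pi) * p^5"
    unfolding u_w_def by (simp add: field_simps eval_nat_numeral)
  also have "\<dots> = integral {0..pi/2} (\<lambda>t. (1 + cos t) * ((2*p*(1-cos t))^2/4 - (2*p*(1-cos t))^3/6 + (2*p*(1-cos t))^4/24 - (2*p*(1-cos t))^5/120)
       - (1 - cos t) * (1 - p * (1 + cos t))^2)"
    by (rule integral_unique[OF has_integral_pair, symmetric])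
  also have "\<dots> \<le> integral {0..pi/2} (\<lambda>t. (1 + cos t) * (exp (- (2 * p * (1 - cos t))) - (1 - p * (1 - cos t))^2)
       - (1 - cos t) * (1 - p * (1 + cos t))^2)"
  proof (intro integral_le diff_right_mono mult_left_mono)
    fix t :: real
    define x where "x = 2 * p * (1 - cos t)"
    have "x \<ge> 0" using assms by (auto simp: x_def)
    have "(1 - p * (1 - cos t))^2 = 1 - x + x^2/4" by (simp add: x_def power2_eq_square field_simps)
    then show "(2*p*(1-cos t))^2/4 - (2*p*(1-cos t))^3/6 + (2*p*(1-cos t))^4/24 - (2*p*(1-cos t))^5/120
        \<le> exp (- (2 * p * (1 - cos t))) - (1 - p * (1 - cos t))^2"
      using exp_neg_taylor(2)[OF \<open>x \<ge> 0\<close>] unfolding x_def[symmetric] by (simp add: field_simps)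
    show "0 \<le> 1 + cos t" using cos_ge_minus_one[of t] by linarith
  qed (intro integrable_continuous_real continuous_intros; simp)+
  finally show ?thesis .
qed


section \<open>From three equal parameters to any larger number\<close>

lemma continuous_on_gain [continuous_intros]:
  "continuous_on S f \<Longrightarrow> continuous_on S (\<lambda>t. gain m p (f t))"
  unfolding gain_def slope_poly_def chord_def by (intro continuous_intros)

text \<open>Single crossing: \<open>slope_poly p\<close> increases, while the ratio of \<open>chord p c\<close> to
  \<open>1 - p + p * c\<close> decreases in \<open>c\<close>.\<close>

lemma gain_sign_change:
  assumes p: "1/2 \<le> p" "p \<le> 1" and c: "0 \<le> c'" "c' \<le> c" "c \<le> 1" and "gain m p c < 0"
  shows "gain m p c' \<le> 0"
proof -
  define v where "v = (\<lambda>c. 1 - p + p * c)"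
  have v: "0 \<le> v c'" "v c' \<le> v c" using p c by (auto simp: v_def mult_left_mono)
  have ch: "0 \<le> chord p c" if "0 \<le> c" "c \<le> 1" for c
  proof -
    have "chord p c = (1 - p) * (1 - c) + (2 * p - 1) * c" by (simp add: chord_def algebra_simps)
    then show ?thesis using p that by simp
  qed
  \<comment> \<open>A zero of \<open>v c\<close> with \<open>m\<close> positive forces
    \<open>p = 1\<close> and \<open>c = 0\<close>, where \<open>gain\<close> vanishes instead of
    being negative.\<close>
  have "v c \<noteq> 0 \<or> m = 0"
  proof (rule ccontr)
    assume "\<not> ?thesis"
    then have "v c = 0" "m \<noteq> 0" by auto
    have "p * c \<ge> 0" using p c by auto
    with \<open>v c = 0\<close> p have "p = 1" by (auto simp: v_def)
    with \<open>v c = 0\<close> have "c = 0" by (simp add: v_def)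
    then have "gain m p c = 0" using \<open>p = 1\<close> \<open>m \<noteq> 0\<close> by (simp add: gain_def chord_def)
    with assms show False by simp
  qed
  then have vpos: "0 < v c ^ m" using v by (cases "m = 0") auto
  have slope: "slope_poly p c' \<le> slope_poly p c"
  proof -
    have "slope_poly p c - slope_poly p c' = p / 2 * ((c - c') * (2 - p / 3 * (1 - 3 * c - 3 * c')))"
      by (simp add: slope_poly_def field_simps)
    moreover have "p / 3 * (1 - 3 * c - 3 * c') \<le> p / 3 * 1" using p c by (intro mult_left_mono) auto
    then have "0 \<le> 2 - p / 3 * (1 - 3 * c - 3 * c')" using p by linarith
    then have "0 \<le> p / 2 * ((c - c') * (2 - p / 3 * (1 - 3 * c - 3 * c')))"
      using p c by (intro mult_nonneg_nonneg) auto
    ultimately show ?thesis by linarith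
  qed
  have cross: "chord p c * v c' \<le> chord p c' * v c"
  proof -
    have "chord p c' * v c - chord p c * v c' = (c - c') * (1 - p)\<^sup>2 * 2"
      by (simp add: chord_def v_def field_simps power2_eq_square)
    moreover have "0 \<le> (c - c') * (1 - p)\<^sup>2 * 2" using c by simp
    ultimately show ?thesis by linarith
  qed
  \<comment> \<open>The two monotonicity facts are chained after multiplication by
    \<open>v c ^ m\<close>, so no quotient \<open>chord / v\<close> has to be formed.\<close>
  have "v c' ^ m * slope_poly p c' * v c ^ m \<le> v c' ^ m * (v c ^ m * slope_poly p c)"
    using mult_left_mono[OF slope, of "v c' ^ m * v c ^ m"] v vpos by (simp add: mult_ac)
  also have "\<dots> \<le> v c' ^ m * chord p c ^ m"
    using assms(6) v by (intro mult_left_mono) (auto simp: gain_def v_def)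
  also have "\<dots> = (chord p c * v c') ^ m" by (simp add: power_mult_distrib)
  also have "\<dots> \<le> (chord p c' * v c) ^ m"
    using ch[of c] c v cross by (intro power_mono) auto
  also have "\<dots> = chord p c' ^ m * v c ^ m" by (simp add: power_mult_distrib)
  finally show ?thesis using vpos by (simp add: gain_def v_def)
qed

text \<open>By single crossing the factor \<open>1 - p + p * c\<close> may be frozen at the crossing point.\<close>

lemma gain_Suc:
  assumes p: "1/2 \<le> p" "p \<le> 1"
  obtains r where "1 - p \<le> r" "\<And>c. 0 \<le> c \<Longrightarrow> c \<le> 1 \<Longrightarrow> r * gain m p c \<le> gain (Suc m) p c"
proof -
  define v where "v = (\<lambda>c. 1 - p + p * c)"
  \<comment> \<open>The supremum of \<open>A\<close> is the value of \<open>v\<close> at the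
    crossing point. The extra element \<open>1 - p\<close>, which is \<open>v 0\<close>, keeps
    \<open>A\<close> nonempty when \<open>gain\<close> is never negative.\<close>
  define A where "A = insert (1 - p) (v ` {c. 0 \<le> c \<and> c \<le> 1 \<and> gain m p c < 0})"
  have vmono: "v c' \<le> v c" if "c' \<le> c" for c c' using p that by (auto simp: v_def mult_left_mono)
  have bdd: "bdd_above A"
    unfolding A_def bdd_above_insert
    by (rule bdd_aboveI[of _ "v 1"]) (auto intro: vmono)
  have r1: "1 - p \<le> Sup A" by (intro cSup_upper bdd) (auto simp: A_def)
  have "Sup A * gain m p c \<le> gain (Suc m) p c" if c: "0 \<le> c" "c \<le> 1" for c
  proof -
    have ch: "0 \<le> chord p c"
    proof -
      have "chord p c = (1 - p) * (1 - c) + (2 * p - 1) * c" by (simp add: chord_def algebra_simps)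
      then show ?thesis using p c by simp
    qed
    \<comment> \<open>Since \<open>chord\<close> lies below \<open>v\<close>, raising the power by
      one multiplies the loss by at most \<open>v c\<close>, while the positive part is multiplied
      by exactly \<open>v c\<close>.\<close>
    have "v c - chord p c = 2 * (1 - p) * c" by (simp add: v_def chord_def algebra_simps)
    moreover have "0 \<le> 2 * (1 - p) * c" using p c by simp
    ultimately have "chord p c \<le> v c" by linarith
    then have "chord p c * chord p c ^ m \<le> v c * chord p c ^ m"
      using ch by (intro mult_right_mono) auto
    then have "v c * gain m p c \<le> gain (Suc m) p c"
      by (simp add: gain_def v_def algebra_simps)
    \<comment> \<open>Where \<open>gain\<close> is negative, \<open>v c\<close> is at most
      \<open>Sup A\<close>; where it is positive, every negative point lies to the left and
      \<open>v c\<close> is at least \<open>Sup A\<close>. Both cases favour this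
      inequality.\<close>
    moreover have "Sup A * gain m p c \<le> v c * gain m p c"
    proof (cases "gain m p c < 0")
      case True
      then have "v c \<le> Sup A" using c by (intro cSup_upper bdd) (auto simp: A_def)
      then show ?thesis using True by (simp add: mult_right_mono_neg)
    next
      case False
      show ?thesis
      proof (cases "gain m p c = 0")
        case False
        have "x \<le> v c" if "x \<in> A" for x
          using that unfolding A_def
        proof
          assume "x = 1 - p" then show ?thesis using vmono[of 0 c] c by (simp add: v_def)
        next
          assume "x \<in> v ` {c. 0 \<le> c \<and> c \<le> 1 \<and> gain m p c < 0}"
          then obtain d where d: "x = v d" "0 \<le> d" "d \<le> 1" "gain m p d < 0" by auto
          have "d \<le> c"
            using gain_sign_change[OF p _ _ d(3,4), of c] c False \<open>\<not> gain m p c < 0\<close> by force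
          then show ?thesis using d vmono by simp
        qed
        then have "Sup A \<le> v c" by (intro cSup_least) (auto simp: A_def)
        then show ?thesis using \<open>\<not> gain m p c < 0\<close> by (intro mult_right_mono) auto
      qed simp
    qed
    ultimately show ?thesis by linarith
  qed
  with r1 show ?thesis by (rule that)
qed

text \<open>Passing from \<open>m\<close> to \<open>m + 1\<close> multiplies the integral by at
  least some \<open>r\<close>, and the boundary term only by \<open>1 - p\<close>, which is at most
  \<open>r\<close>. So the case of three parameters propagates.\<close>

lemma gain_bound:
  assumes p: "1/2 \<le> p" "p \<le> 1" and m: "3 \<le> m"
  shows "p/2*(1-p/3)*(1-p)^m \<le> integral {0..pi/2} (\<lambda>t. (1 - cos t) * gain m p (cos t))"
  using m
proof (induction m rule: dec_induct)
  case base
  show ?case using gain_3_bound[OF p] .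
next
  case (step m)
  obtain r where r: "1 - p \<le> r" "\<And>c. 0 \<le> c \<Longrightarrow> c \<le> 1 \<Longrightarrow> r * gain m p c \<le> gain (Suc m) p c"
    using gain_Suc[OF p] by metis
  have "p/2*(1-p/3)*(1-p)^Suc m = (1 - p) * (p/2*(1-p/3)*(1-p)^m)" by simp
  also have "\<dots> \<le> r * (p/2*(1-p/3)*(1-p)^m)"
    using r(1) p by (intro mult_right_mono) auto
  also have "\<dots> \<le> r * integral {0..pi/2} (\<lambda>t. (1 - cos t) * gain m p (cos t))"
    using step.IH r(1) p by (intro mult_left_mono) auto
  also have "\<dots> = integral {0..pi/2} (\<lambda>t. r * ((1 - cos t) * gain m p (cos t)))"
    by simp
  also have "\<dots> \<le> integral {0..pi/2} (\<lambda>t. (1 - cos t) * gain (Suc m) p (cos t))"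
  proof (rule integral_le)
    fix t :: real assume "t \<in> {0..pi/2}"
    then have "0 \<le> cos t" by (intro cos_ge_zero) auto
    then have "(1 - cos t) * (r * gain m p (cos t)) \<le> (1 - cos t) * gain (Suc m) p (cos t)"
      by (intro mult_left_mono r) auto
    then show "r * ((1 - cos t) * gain m p (cos t)) \<le> (1 - cos t) * gain (Suc m) p (cos t)"
      by (simp add: mult_ac)
  qed (intro integrable_continuous_real continuous_intros)+
  finally show ?case .
qed

text \<open>Put \<open>x = p * (1 - cos t)\<close>. Factoring the difference of powers gives
  \<open>exp (-x) ^ m - v ^ m\<close> at least \<open>m * v ^ (m - 1) * (x^2/2 - x^3/6)\<close>.
  Modulo the derivative \<open>D\<close> this leaves \<open>gain\<close>, and
  \<open>gain_bound\<close> pays for the integral of \<open>D\<close>.\<close>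

lemma fold_bound_chord:
  assumes p: "1/2 \<le> p" "p \<le> 1" and m: "3 \<le> m"
  shows "0 \<le> integral {0..pi/2} (\<lambda>t. (1 + cos t) * (exp (- (m * p * (1 - cos t))) - (1 - p * (1 - cos t))^m)
       - (1 - cos t) * chord p (cos t) ^ m)"
proof -
  define v where "v = (\<lambda>t. 1 - p + p * cos t)"
  \<comment> \<open>\<open>H\<close> is chosen so that
    \<open>p * sin t * H t = (1 + cos t) * (x^2/2 - x^3/6)\<close>. As \<open>v\<close> has
    derivative \<open>- p * sin t\<close>, the first summand of \<open>D\<close>, the derivative of
    \<open>v ^ m * H\<close>, is minus the lower bound for the gain.\<close>
  define H where "H = (\<lambda>t. p/2 * (1 - cos t) * sin t * (1 - p * (1 - cos t) / 3))"
  define D where "D = (\<lambda>t. m * v t ^ (m - 1) * (- p * sin t) * H t + v t ^ m * ((1 - cos t) * slope_poly p (cos t)))"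
  have "(D has_integral (v (pi/2) ^ m * H (pi/2) - v 0 ^ m * H 0)) {0..pi/2}"
  proof (rule fundamental_theorem_of_calculus)
    fix t :: real
    have s: "sin t * sin t = 1 - cos t * cos t"
      using sin_cos_squared_add[of t] by (simp add: power2_eq_square)
    have "(H has_real_derivative p/2 * (sin t * sin t * (1 - p * (1 - cos t) / 3)
        + (1 - cos t) * cos t * (1 - p * (1 - cos t) / 3) - (1 - cos t) * (p / 3) * (sin t * sin t))) (at t within {0..pi/2})"
      unfolding H_def by (auto intro!: derivative_eq_intros simp: field_simps)
    also have "p/2 * (sin t * sin t * (1 - p * (1 - cos t) / 3)
        + (1 - cos t) * cos t * (1 - p * (1 - cos t) / 3) - (1 - cos t) * (p / 3) * (sin t * sin t))
        = (1 - cos t) * slope_poly p (cos t)"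
      unfolding s slope_poly_def by (simp add: field_simps)
    finally have H: "(H has_real_derivative (1 - cos t) * slope_poly p (cos t)) (at t within {0..pi/2})" .
    have v: "((\<lambda>t. v t ^ m) has_real_derivative m * v t ^ (m - 1) * (- p * sin t)) (at t within {0..pi/2})"
      unfolding v_def by (auto intro!: derivative_eq_intros)
    show "((\<lambda>t. v t ^ m * H t) has_vector_derivative D t) (at t within {0..pi/2})"
      using DERIV_mult[OF v H] by (simp add: D_def has_real_derivative_iff_has_vector_derivative add.commute mult.commute)
  qed simp
  moreover have "v (pi/2) ^ m * H (pi/2) - v 0 ^ m * H 0 = p/2*(1-p/3)*(1-p)^m"
    by (simp add: H_def v_def)
  ultimately have D: "(D has_integral p/2*(1-p/3)*(1-p)^m) {0..pi/2}" by simp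
  have "0 \<le> integral {0..pi/2} (\<lambda>t. (1 - cos t) * gain m p (cos t)) - integral {0..pi/2} D"
    using gain_bound[OF p m] integral_unique[OF D] by simp
  also have "\<dots> = integral {0..pi/2} (\<lambda>t. (1 - cos t) * gain m p (cos t) - D t)"
    by (intro integral_diff[symmetric] has_integral_integrable[OF D] integrable_continuous_real continuous_intros)
  also have "\<dots> \<le> integral {0..pi/2} (\<lambda>t. (1 + cos t) * (exp (- (m * p * (1 - cos t))) - (1 - p * (1 - cos t))^m)
       - (1 - cos t) * chord p (cos t) ^ m)"
  proof (rule integral_le)
    fix t :: real assume t: "t \<in> {0..pi/2}"
    then have c: "0 \<le> cos t" by (intro cos_ge_zero) auto
    have s: "sin t * sin t = 1 - cos t * cos t"
      using sin_cos_squared_add[of t] by (simp add: power2_eq_square)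
    define x where "x = p * (1 - cos t)"
    have vx: "v t = 1 - x" by (simp add: v_def x_def algebra_simps)
    have x: "0 \<le> x" using p by (auto simp: x_def)
    have v0: "0 \<le> v t" using c p by (auto simp: v_def)
    have "v t \<le> exp (-x)" using exp_ge_add_one_self[of "-x"] vx by simp
    have "m * v t ^ (m - 1) * (x^2/2 - x^3/6) \<le> m * v t ^ (m - 1) * (exp (-x) - v t)"
      using exp_neg_taylor(1)[OF x] v0 vx by (intro mult_left_mono) auto
    also have "\<dots> \<le> exp (-x) ^ m - v t ^ m"
    proof -
      have "exp (-x) ^ m - v t ^ m = (exp (-x) - v t) * (\<Sum>i<m. exp (-x) ^ i * v t ^ (m - Suc i))"
        by (simp add: power_diff_sumr2 mult.commute)
      moreover have "(\<Sum>i<m. v t ^ (m - 1)) \<le> (\<Sum>i<m. exp (-x) ^ i * v t ^ (m - Suc i))"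
      proof (rule sum_mono)
        fix i assume "i \<in> {..<m}"
        then have "v t ^ (m - 1) = v t ^ i * v t ^ (m - Suc i)" by (simp flip: power_add)
        also have "\<dots> \<le> exp (-x) ^ i * v t ^ (m - Suc i)"
          using v0 \<open>v t \<le> exp (-x)\<close> by (intro mult_right_mono power_mono) auto
        finally show "v t ^ (m - 1) \<le> exp (-x) ^ i * v t ^ (m - Suc i)" .
      qed
      ultimately have "(exp (-x) - v t) * (\<Sum>i<m. v t ^ (m - 1)) \<le> exp (-x) ^ m - v t ^ m"
        using \<open>v t \<le> exp (-x)\<close> by (simp only: mult_left_mono diff_ge_0_iff_ge)
      then show ?thesis by (simp add: mult_ac)
    qed
    finally have *: "(1 + cos t) * (m * v t ^ (m - 1) * (x^2/2 - x^3/6)) \<le> (1 + cos t) * (exp (-x) ^ m - v t ^ m)"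
      using c by (intro mult_left_mono) auto
    have "p * sin t * H t = p^2/2 * (1 - cos t) * (sin t * sin t) * (1 - p * (1 - cos t) / 3)"
      by (simp add: H_def power2_eq_square)
    also have "\<dots> = (1 + cos t) * (x^2/2 - x^3/6)"
      unfolding s x_def by (simp add: field_simps eval_nat_numeral)
    finally have H: "p * sin t * H t = (1 + cos t) * (x^2/2 - x^3/6)" .
    have "D t = v t ^ m * ((1 - cos t) * slope_poly p (cos t)) - m * v t ^ (m - 1) * (p * sin t * H t)"
      by (simp add: D_def)
    also have "\<dots> = v t ^ m * ((1 - cos t) * slope_poly p (cos t)) - (1 + cos t) * (m * v t ^ (m - 1) * (x^2/2 - x^3/6))"
      unfolding H by (simp only: mult_ac)
    finally have "D t = \<dots>" .
    then have "(1 - cos t) * gain m p (cos t) - D t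
       = (1 + cos t) * (m * v t ^ (m - 1) * (x^2/2 - x^3/6)) - (1 - cos t) * chord p (cos t) ^ m"
      by (simp add: gain_def v_def algebra_simps)
    also have "\<dots> \<le> (1 + cos t) * (exp (-x) ^ m - v t ^ m) - (1 - cos t) * chord p (cos t) ^ m"
      using * by simp
    also have "exp (-x) ^ m = exp (- (m * p * (1 - cos t)))"
      by (simp add: x_def flip: exp_of_nat_mult)
    finally show "(1 - cos t) * gain m p (cos t) - D t
       \<le> (1 + cos t) * (exp (- (m * p * (1 - cos t))) - (1 - p * (1 - cos t))^m) - (1 - cos t) * chord p (cos t) ^ m"
      by (simp add: vx x_def)
  next
    show "(\<lambda>t. (1 - cos t) * gain m p (cos t) - D t) integrable_on {0..pi/2}"
      by (intro integrable_diff has_integral_integrable[OF D] integrable_continuous_real continuous_intros)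
    show "(\<lambda>t. (1 + cos t) * (exp (- (m * p * (1 - cos t))) - (1 - p * (1 - cos t))^m)
       - (1 - cos t) * chord p (cos t) ^ m) integrable_on {0..pi/2}"
      unfolding chord_def by (intro integrable_continuous_real continuous_intros)
  qed
  finally show ?thesis .
qed


section \<open>The product against its exponential majorant\<close>

lemma prod_le_mean_power:
  fixes x :: "'i \<Rightarrow> real"
  assumes "finite S" "\<And>i. i \<in> S \<Longrightarrow> 0 \<le> x i"
  shows "(\<Prod>i\<in>S. x i) \<le> ((\<Sum>i\<in>S. x i) / card S) ^ card S"
proof (cases "S = {}")
  case False
  then have n: "0 < card S" using assms by (simp add: card_gt_0_iff)
  let ?P = "\<Prod>i\<in>S. x i"
  have P: "0 \<le> ?P" using assms by (simp add: prod_nonneg)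
  have "?P = (?P powr (1 / card S)) powr card S"
    using P n by (simp add: powr_powr)
  also have "\<dots> = (?P powr (1 / card S)) ^ card S"
    using n by (intro powr_realpow') auto
  also have "\<dots> \<le> ((\<Sum>i\<in>S. x i) / card S) ^ card S"
    using arith_geom_mean[OF assms(1) False, of x] assms(2)
    by (intro power_mono) (auto simp: sum_divide_distrib)
  finally show ?thesis .
qed simp

lemma prod_one_minus_le_exp:
  fixes x :: "'i \<Rightarrow> real"
  assumes "finite S" "\<And>i. i \<in> S \<Longrightarrow> x i \<le> 1"
  shows "(\<Prod>i\<in>S. 1 - x i) \<le> exp (- (\<Sum>i\<in>S. x i))"
proof -
  have "(\<Prod>i\<in>S. 1 - x i) \<le> (\<Prod>i\<in>S. exp (- x i))"
    using assms exp_ge_add_one_self[of "- x i" for i] by (intro prod_mono) auto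
  also have "\<dots> = exp (- (\<Sum>i\<in>S. x i))"
    using assms by (simp add: exp_sum flip: sum_negf)
  finally show ?thesis .
qed

lemma integral_fold:
  fixes f :: "real \<Rightarrow> real"
  assumes "continuous_on {0..a} f" "0 \<le> a"
  shows "integral {0..a} f = integral {0..a/2} (\<lambda>t. f t + f (a - t))"
proof -
  have i: "f integrable_on {x..y}" if "0 \<le> x" "y \<le> a" for x y
    using that assms by (intro integrable_continuous_real continuous_on_subset[OF assms(1)]) auto
  have "(f has_integral integral {a/2..a} f) (cbox (a/2) a)"
    using i[of "a/2" a] assms by (simp add: integrable_integral)
  from has_integral_affinity[OF this, of "-1" a]
  have r: "((\<lambda>t. f (a - t)) has_integral integral {a/2..a} f) ((\<lambda>x. a - x) ` {a/2..a})"
    by simp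
  have "(\<lambda>x. a - x) ` {a/2..a} = {0..a/2}"
    using assms by (auto simp: image_iff intro!: bexI[of _ "a - _"])
  with r have r: "((\<lambda>t. f (a - t)) has_integral integral {a/2..a} f) {0..a/2}" by simp
  have "integral {0..a} f = integral {0..a/2} f + integral {a/2..a} f"
    using assms i[of 0 a] by (intro Henstock_Kurzweil_Integration.integral_combine[symmetric]) auto
  also have "\<dots> = integral {0..a/2} (\<lambda>t. f t + f (a - t))"
    using i[of 0 "a/2"] assms r
    by (subst Henstock_Kurzweil_Integration.integral_add) (auto simp: integral_unique has_integral_integrable)
  finally show ?thesis .
qed

text \<open>\<open>B t\<close> dominates the product at \<open>pi - t\<close>, where its factors may be negative.\<close>

lemma prod_large_fold_bound:
  fixes p :: "'i \<Rightarrow> real"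
  assumes L: "finite L" "2 \<le> card L" and p: "\<And>i. i \<in> L \<Longrightarrow> 1/2 \<le> p i \<and> p i \<le> 1"
  obtains B where "continuous_on UNIV B"
    "\<And>t. 0 \<le> cos t \<Longrightarrow> 0 \<le> B t"
    "\<And>t. 0 \<le> cos t \<Longrightarrow> (\<Prod>i\<in>L. 1 - p i * (1 + cos t)) \<le> B t"
    "0 \<le> integral {0..pi/2} (\<lambda>t. (1 + cos t) * (exp (- (sum p L * (1 - cos t)))
       - (1 - sum p L / card L * (1 - cos t)) ^ card L) - (1 - cos t) * B t)"
proof -
  define q where "q = sum p L / card L"
  have sum: "sum p L = card L * q" using L by (simp add: q_def)
  have "(\<Sum>i\<in>L. 1/2) \<le> sum p L" "sum p L \<le> (\<Sum>i\<in>L. 1)"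
    by (rule sum_mono, use p in blast)+
  then have q: "1/2 \<le> q" "q \<le> 1" using L by (auto simp: q_def field_simps)
  show ?thesis
  \<comment> \<open>Two factors obey the arithmetic-geometric mean inequality in squared form
    whatever their signs. For three or more, nonnegative majorants have to be taken first.\<close>
  proof (cases "card L = 2")
    case True
    show ?thesis
    proof (rule that[of "\<lambda>t. (1 - q * (1 + cos t))\<^sup>2"])
      fix t
      obtain i j where ij: "L = {i, j}" "i \<noteq> j" using True by (auto simp: card_2_iff)
      define x y where "x = 1 - p i * (1 + cos t)" "y = 1 - p j * (1 + cos t)"
      have "1 - q * (1 + cos t) = (x + y) / 2"
        using ij by (simp add: q_def x_y_def field_simps)
      moreover have "x * y \<le> ((x + y) / 2)\<^sup>2"
        using zero_le_power2[of "x - y"] by (simp add: power2_eq_square field_simps)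
      ultimately have "x * y \<le> (1 - q * (1 + cos t))\<^sup>2" by (simp only:)
      then show "(\<Prod>i\<in>L. 1 - p i * (1 + cos t)) \<le> (1 - q * (1 + cos t))\<^sup>2"
        using ij by (simp add: x_y_def)
    next
      show "0 \<le> integral {0..pi/2} (\<lambda>t. (1 + cos t) * (exp (- (sum p L * (1 - cos t)))
       - (1 - sum p L / card L * (1 - cos t)) ^ card L) - (1 - cos t) * (1 - q * (1 + cos t))\<^sup>2)"
        using fold_bound_pair[OF q] unfolding q_def[symmetric] sum True by simp
    qed (intro continuous_intros, simp)
  next
    case False
    with L have m: "3 \<le> card L" by simp
    have ch: "\<bar>1 - p i * (1 + c)\<bar> \<le> chord (p i) c" if "i \<in> L" "0 \<le> c" "c \<le> 1" for i c
    proof -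
      have "chord (p i) c - (1 - p i * (1 + c)) = 2 * (2 * p i - 1) * c"
        "chord (p i) c + (1 - p i * (1 + c)) = 2 * (1 - p i) * (1 - c)"
        by (simp_all add: chord_def algebra_simps)
      moreover have "0 \<le> 2 * (2 * p i - 1) * c" "0 \<le> 2 * (1 - p i) * (1 - c)"
        using p[of i] that by (auto intro!: mult_nonneg_nonneg)
      ultimately show ?thesis by linarith
    qed
    \<comment> \<open>\<open>chord\<close> is affine in its first argument, so averaging over
      \<open>L\<close> gives the chord at the mean \<open>q\<close>.\<close>
    have mean: "(\<Sum>i\<in>L. chord (p i) c) / card L = chord q c" for c
    proof -
      have "(\<Sum>i\<in>L. chord (p i) c) = (\<Sum>i\<in>L. (1 - 2 * c) + (3 * c - 1) * p i)"
        by (intro sum.cong) (auto simp: chord_def algebra_simps)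
      also have "\<dots> = card L * (1 - 2 * c) + (3 * c - 1) * (card L * q)"
        unfolding sum[symmetric] by (simp add: sum.distrib sum_distrib_left)
      also have "\<dots> = card L * chord q c" by (simp add: chord_def algebra_simps)
      finally show ?thesis using L by auto
    qed
    have nn: "0 \<le> chord (p i) c" if "i \<in> L" "0 \<le> c" "c \<le> 1" for i c
      using ch[OF that] by linarith
    have prod: "(\<Prod>i\<in>L. \<bar>1 - p i * (1 + c)\<bar>) \<le> chord q c ^ card L" if "0 \<le> c" "c \<le> 1" for c
    proof -
      have "(\<Prod>i\<in>L. \<bar>1 - p i * (1 + c)\<bar>) \<le> (\<Prod>i\<in>L. chord (p i) c)"
        using ch that by (intro prod_mono) auto
      also have "\<dots> \<le> chord q c ^ card L"
        unfolding mean[symmetric] using nn that L by (intro prod_le_mean_power) auto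
      finally show ?thesis .
    qed
    show ?thesis
    proof (rule that[of "\<lambda>t. chord q (cos t) ^ card L"])
      fix t :: real assume t: "0 \<le> cos t"
      then show "0 \<le> chord q (cos t) ^ card L"
        using prod[of "cos t"] prod_nonneg[of L "\<lambda>i. \<bar>1 - p i * (1 + cos t)\<bar>"] by force
      have "(\<Prod>i\<in>L. 1 - p i * (1 + cos t)) \<le> \<bar>\<Prod>i\<in>L. 1 - p i * (1 + cos t)\<bar>" by simp
      also have "\<dots> \<le> chord q (cos t) ^ card L"
        using prod[of "cos t"] t by (simp add: abs_prod)
      finally show "(\<Prod>i\<in>L. 1 - p i * (1 + cos t)) \<le> chord q (cos t) ^ card L" .
    next
      show "0 \<le> integral {0..pi/2} (\<lambda>t. (1 + cos t) * (exp (- (sum p L * (1 - cos t)))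
       - (1 - sum p L / card L * (1 - cos t)) ^ card L) - (1 - cos t) * chord q (cos t) ^ card L)"
        using fold_bound_chord[OF q m] unfolding sum[symmetric] q_def[symmetric] .
      show "continuous_on UNIV (\<lambda>t. chord q (cos t) ^ card L)"
        unfolding chord_def by (intro continuous_intros)
    qed
  qed
qed

text \<open>Only factors with \<open>p i > 1/2\<close> can be negative. If there is at most one of
  them, the product is either bounded factor by factor or nonpositive, and the comparison is
  pointwise. Otherwise the integral is folded at pi/2 and the large parameters carry the
  estimate.\<close>

lemma integral_prod_cos_le_exp:
  fixes p :: "'i \<Rightarrow> real"
  assumes I: "finite I" and p: "\<And>i. i \<in> I \<Longrightarrow> 0 \<le> p i \<and> p i \<le> 1"
  shows "integral {0..pi} (\<lambda>t. (1 + cos t) * (\<Prod>i\<in>I. 1 - p i * (1 - cos t)))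
    \<le> integral {0..pi} (\<lambda>t. (1 + cos t) * exp (- (sum p I * (1 - cos t))))"
proof -
  define L S where "L = {i \<in> I. 1/2 < p i}" "S = {i \<in> I. p i \<le> 1/2}"
  have LS: "I = L \<union> S" "L \<inter> S = {}" "finite L" "finite S"
    using I by (auto simp: L_S_def)
  have int: "(\<lambda>t. (1 + cos t) * (\<Prod>i\<in>I. 1 - p i * (1 - cos t))) integrable_on {0..pi}"
     "(\<lambda>t. (1 + cos t) * exp (- (sum p I * (1 - cos t)))) integrable_on {0..pi}"
    by (intro integrable_continuous_real continuous_intros)+
  show ?thesis
  proof (cases "2 \<le> card L")
    case False
    have le: "(\<Prod>i\<in>I. 1 - p i * (1 - c)) \<le> exp (- (sum p I * (1 - c)))" if c: "-1 \<le> c" "c \<le> 1" for c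
    proof (cases "\<forall>i\<in>I. p i * (1 - c) \<le> 1")
      case True
      then show ?thesis
        using prod_one_minus_le_exp[of I "\<lambda>i. p i * (1 - c)"] I by (simp add: sum_distrib_right)
    next
      case neg: False
      then obtain i where i: "i \<in> I" "1 < p i * (1 - c)" by force
      have small: "p j * (1 - c) \<le> 1" if "j \<in> S" for j
        using mult_mono[of "p j" "1/2" "1 - c" 2] that c p[of j] by (auto simp: L_S_def)
      have "i \<in> L" using i small[of i] by (force simp: L_S_def)
      have "L = {i}"
      proof (rule ccontr)
        assume "L \<noteq> {i}"
        then obtain j where "j \<in> L" "j \<noteq> i" using \<open>i \<in> L\<close> by auto
        then have "card {i, j} \<le> card L" using \<open>i \<in> L\<close> LS by (intro card_mono) auto
        with \<open>j \<noteq> i\<close> False show False by simp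
      qed
      then have "(\<Prod>j\<in>I. 1 - p j * (1 - c)) = (1 - p i * (1 - c)) * (\<Prod>j\<in>S. 1 - p j * (1 - c))"
        using LS by (simp add: prod.union_disjoint)
      also have "\<dots> \<le> 0"
        using i small by (intro mult_nonpos_nonneg prod_nonneg) auto
      also have "0 \<le> exp (- (sum p I * (1 - c)))" by simp
      finally show ?thesis .
    qed
    have "0 \<le> 1 + cos t" for t :: real using cos_ge_minus_one[of t] by linarith
    then show ?thesis by (intro integral_le int mult_left_mono le) auto
  next
    case True
    then have "L \<noteq> {}" by auto
    obtain B where B: "continuous_on UNIV B"
      "\<And>t. 0 \<le> cos t \<Longrightarrow> 0 \<le> B t"
      "\<And>t. 0 \<le> cos t \<Longrightarrow> (\<Prod>i\<in>L. 1 - p i * (1 + cos t)) \<le> B t"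
      "0 \<le> integral {0..pi/2} (\<lambda>t. (1 + cos t) * (exp (- (sum p L * (1 - cos t)))
         - (1 - sum p L / card L * (1 - cos t)) ^ card L) - (1 - cos t) * B t)"
      by (rule prod_large_fold_bound[OF LS(3) True, of p]) (use p in \<open>auto simp: L_S_def\<close>)
    define v where "v = (\<lambda>c. 1 - sum p L / card L * (1 - c))"
    define f where "f = (\<lambda>t. (1 + cos t) * exp (- (sum p I * (1 - cos t)))
       - (1 + cos t) * (\<Prod>i\<in>I. 1 - p i * (1 - cos t)))"
    have contB: "continuous_on A B" for A using B(1) continuous_on_subset by blast
    \<comment> \<open>For \<open>c = cos t\<close> nonnegative, \<open>exp (- sum p S)\<close> is a
      lower bound for the small parameters' exponential at \<open>t\<close> and an upper bound for
      the one at pi - t. It can therefore be factored out of gain and loss alike.\<close>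
    have "0 \<le> exp (- sum p S) * integral {0..pi/2} (\<lambda>t. (1 + cos t) * (exp (- (sum p L * (1 - cos t)))
         - v (cos t) ^ card L) - (1 - cos t) * B t)"
      using B(4) by (simp add: v_def)
    also have "\<dots> = integral {0..pi/2} (\<lambda>t. exp (- sum p S) * ((1 + cos t) * (exp (- (sum p L * (1 - cos t)))
         - v (cos t) ^ card L) - (1 - cos t) * B t))"
      by simp
    also have "\<dots> \<le> integral {0..pi/2} (\<lambda>t. f t + f (pi - t))"
    proof (rule integral_le)
      fix t :: real assume "t \<in> {0..pi/2}"
      then have c0: "0 \<le> cos t" by (intro cos_ge_zero) auto
      define c where "c = cos t"
      have c: "0 \<le> c" "c \<le> 1" using c0 by (auto simp: c_def)
      have pL: "p i * (1 - c) \<le> 1" if "i \<in> I" for i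
        using p[OF that] c by (intro mult_le_one) auto
      have pS: "p i * (1 + c) \<le> 1" if "i \<in> S" for i
        using mult_mono[of "p i" "1/2" "1 + c" 2] that c p[of i] by (auto simp: L_S_def)
      have sum: "sum p I = sum p L + sum p S" using LS by (simp add: sum.union_disjoint)
      have S0: "0 \<le> sum p S" using p by (intro sum_nonneg) (auto simp: L_S_def)
      have mean: "(\<Sum>i\<in>L. 1 - p i * (1 - c)) / card L = v c"
        using \<open>L \<noteq> {}\<close> LS by (simp add: v_def sum_subtractf sum.distrib field_simps flip: sum_distrib_right sum_distrib_left)
      have AL: "(\<Prod>i\<in>L. 1 - p i * (1 - c)) \<le> v c ^ card L"
        unfolding mean[symmetric] using LS pL by (intro prod_le_mean_power) auto
      have v: "v c ^ card L \<le> exp (- (sum p L * (1 - c)))"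
      proof -
        have "0 \<le> v c" unfolding mean[symmetric] using pL LS by (intro divide_nonneg_nonneg sum_nonneg) auto
        moreover have "v c \<le> exp (- (sum p L / card L * (1 - c)))"
          using exp_ge_add_one_self[of "- (sum p L / card L * (1 - c))"] by (simp add: v_def)
        ultimately have "v c ^ card L \<le> exp (- (sum p L / card L * (1 - c))) ^ card L"
          by (intro power_mono)
        also have "\<dots> = exp (- (sum p L * (1 - c)))"
          using True by (simp flip: exp_of_nat_mult)
        finally show ?thesis .
      qed
      have "(\<Prod>i\<in>I. 1 - p i * (1 - c)) = (\<Prod>i\<in>L. 1 - p i * (1 - c)) * (\<Prod>i\<in>S. 1 - p i * (1 - c))"
        using LS by (simp add: prod.union_disjoint)
      also have "\<dots> \<le> v c ^ card L * exp (- (sum p S * (1 - c)))"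
        using prod_one_minus_le_exp[of S "\<lambda>i. p i * (1 - c)"] LS pL AL
        by (intro mult_mono' prod_nonneg) (auto simp: sum_distrib_right)
      finally have "exp (- (sum p S * (1 - c))) * (exp (- (sum p L * (1 - c))) - v c ^ card L)
          \<le> exp (- (sum p I * (1 - c))) - (\<Prod>i\<in>I. 1 - p i * (1 - c))"
        by (simp add: sum algebra_simps flip: exp_add)
      moreover have "exp (- sum p S) * (exp (- (sum p L * (1 - c))) - v c ^ card L)
          \<le> exp (- (sum p S * (1 - c))) * (exp (- (sum p L * (1 - c))) - v c ^ card L)"
        using v S0 c mult_left_mono[of "1 - c" 1 "sum p S"] by (intro mult_right_mono) auto
      ultimately have 1: "(1 + c) * (exp (- sum p S) * (exp (- (sum p L * (1 - c))) - v c ^ card L))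
          \<le> (1 + c) * (exp (- (sum p I * (1 - c))) - (\<Prod>i\<in>I. 1 - p i * (1 - c)))"
        using c by (intro mult_left_mono) auto
      have "(\<Prod>i\<in>I. 1 - p i * (1 + c)) = (\<Prod>i\<in>L. 1 - p i * (1 + c)) * (\<Prod>i\<in>S. 1 - p i * (1 + c))"
        using LS by (simp add: prod.union_disjoint)
      also have "\<dots> \<le> B t * (\<Prod>i\<in>S. 1 - p i * (1 + c))"
        using B(3)[OF c0] pS by (intro mult_right_mono prod_nonneg) (auto simp: c_def)
      also have "\<dots> \<le> B t * exp (- (sum p S * (1 + c)))"
        using prod_one_minus_le_exp[of S "\<lambda>i. p i * (1 + c)"] LS pS B(2)[OF c0]
        by (intro mult_left_mono) (auto simp: sum_distrib_right)
      also have "\<dots> \<le> B t * exp (- sum p S)"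
        using S0 c B(2)[OF c0] mult_left_mono[of 1 "1 + c" "sum p S"] by (intro mult_left_mono) auto
      finally have "(1 - c) * (\<Prod>i\<in>I. 1 - p i * (1 + c)) \<le> (1 - c) * (B t * exp (- sum p S))"
        using c by (intro mult_left_mono) auto
      note 2 = this
      \<comment> \<open>The exponential majorant at pi - t is simply discarded.\<close>
      have 3: "0 \<le> (1 - c) * exp (- (sum p I * (1 + c)))" using c by auto
      have alg: "u * ((1 + c) * (e - w) - (1 - c) * b) \<le> ((1 + c) * x - (1 + c) * y) + ((1 - c) * x' - (1 - c) * y')"
        if "(1 + c) * (u * (e - w)) \<le> (1 + c) * (x - y)" "(1 - c) * y' \<le> (1 - c) * (b * u)" "0 \<le> (1 - c) * x'"
        for u e w b x y x' y' :: real
        using that by (simp add: algebra_simps)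
      show "exp (- sum p S) * ((1 + cos t) * (exp (- (sum p L * (1 - cos t)))
         - v (cos t) ^ card L) - (1 - cos t) * B t) \<le> f t + f (pi - t)"
        using alg[OF 1 2 3] unfolding f_def cos_pi_minus c_def[symmetric] by simp
    next
      show "(\<lambda>t. exp (- sum p S) * ((1 + cos t) * (exp (- (sum p L * (1 - cos t)))
         - v (cos t) ^ card L) - (1 - cos t) * B t)) integrable_on {0..pi/2}"
        unfolding v_def by (intro integrable_continuous_real continuous_intros contB)
      show "(\<lambda>t. f t + f (pi - t)) integrable_on {0..pi/2}"
        unfolding f_def by (intro integrable_continuous_real continuous_intros)
    qed
    also have "\<dots> = integral {0..pi} f"
      unfolding f_def by (intro integral_fold[symmetric] continuous_intros) auto
    also have "\<dots> = integral {0..pi} (\<lambda>t. (1 + cos t) * exp (- (sum p I * (1 - cos t))))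
      - integral {0..pi} (\<lambda>t. (1 + cos t) * (\<Prod>i\<in>I. 1 - p i * (1 - cos t)))"
      unfolding f_def by (intro Henstock_Kurzweil_Integration.integral_diff int)
    finally show ?thesis by simp
  qed
qed

section \<open>Kleitman's induction for concentrated laws\<close>

text \<open>If the infimum \<open>l\<close> is not attained, \<open>B\<close> fits into
  \<open>{l<..l+h}\<close>. If it is attained, \<open>B\<close> lies in \<open>{l..<l+h}\<close>,
  closed at the wrong end, and is exhausted by sets that fit into intervals shifted slightly to the
  left.\<close>

lemma measure_short_set_le:
  fixes M :: "real measure" and h :: real
  assumes M: "prob_space M" and [simp]: "sets M = sets borel" and h: "0 < h" and le: "\<And>x. measure M {x<..x+h} \<le> \<alpha>"
    and B: "B \<in> sets borel" and short: "\<And>y z. y \<in> B \<Longrightarrow> z \<in> B \<Longrightarrow> z - y < h"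
  shows "measure M B \<le> \<alpha>"
proof (cases "B = {}")
  case True
  then show ?thesis using order_trans[OF measure_nonneg le[of 0]] by simp
next
  case False
  interpret prob_space M by fact
  define l where "l = Inf B"
  obtain b where "b \<in> B" using False by auto
  have "bdd_below B" using short[OF _ \<open>b \<in> B\<close>] by (intro bdd_belowI[of _ "b - h"]) force
  then have low: "l \<le> y" if "y \<in> B" for y unfolding l_def using that by (rule cInf_lower[rotated])
  have up: "z - h \<le> l" if "z \<in> B" for z
    unfolding l_def using False short[OF _ that] by (intro cInf_greatest) force+
  show ?thesis
  proof (cases "l \<in> B")
    case False
    have "B \<subseteq> {l<..l+h}" using low up False by (force simp: less_le)
    then have "measure M B \<le> measure M {l<..l+h}" by (intro finite_measure_mono) auto
    then show ?thesis using le[of l] by linarith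
  next
    case True
    define A where "A = (\<lambda>k::nat. B \<inter> {..l + h - 1 / Suc k})"
    have "B \<subseteq> (\<Union>k. A k)"
    proof
      fix z assume "z \<in> B"
      then have "0 < l + h - z" using short[OF True \<open>z \<in> B\<close>] by simp
      then obtain k where "1 / Suc k < l + h - z" using nat_approx_posE by blast
      with \<open>z \<in> B\<close> have "z \<in> A k" by (auto simp: A_def)
      then show "z \<in> (\<Union>k. A k)" by blast
    qed
    then have "(\<Union>k. A k) = B" by (auto simp: A_def)
    moreover have "incseq A"
      unfolding A_def by (intro monoI Int_mono) (auto intro!: diff_left_mono frac_le elim!: order_trans)
    moreover have "range A \<subseteq> sets M" using B by (auto simp: A_def)
    ultimately have "(\<lambda>k. measure M (A k)) \<longlonglongrightarrow> measure M B"
      using finite_Lim_measure_incseq[of A] by metis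
    moreover have "measure M (A k) \<le> \<alpha>" for k
    proof -
      have "measure M (A k) \<le> measure M {l - 1 / Suc k<..(l - 1 / Suc k) + h}"
      proof (rule finite_measure_mono)
        show "A k \<subseteq> {l - 1 / Suc k<..(l - 1 / Suc k) + h}"
        proof
          fix z assume "z \<in> A k"
          then have "l \<le> z" "z \<le> l + h - 1 / Suc k" using low by (auto simp: A_def)
          moreover have "0 < 1 / real (Suc k)" by simp
          ultimately show "z \<in> {l - 1 / Suc k<..(l - 1 / Suc k) + h}"
            unfolding greaterThanAtMost_iff by linarith
        qed
      qed simp
      then show ?thesis using le[of "l - 1 / Suc k"] by linarith
    qed
    ultimately show ?thesis by (intro LIMSEQ_le_const2) auto
  qed
qed

text \<open>The proof covers \<open>G\<close> twice and \<open>H\<close> once by two intervals of diameter less than \<open>h\<close>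
  in the sense of the preceding lemma.\<close>

lemma measure_opposite_levels_le:
  fixes M :: "real measure" and h :: real
  assumes M: "prob_space M" and S[simp]: "sets M = sets borel" and h: "0 < h" and le: "\<And>x. measure M {x<..x+h} \<le> \<alpha>"
    and \<alpha>: "1/2 \<le> \<alpha>" and G: "G \<in> sets borel" and H: "H \<in> sets borel"
    and GH: "G \<subseteq> H" and dist: "\<And>a z. a \<in> G \<Longrightarrow> z \<in> H \<Longrightarrow> \<bar>z - a\<bar> < h"
  shows "measure M G + measure M H \<le> 2 * \<alpha>"
proof (cases "G = {}")
  case True
  \<comment> \<open>With \<open>G\<close> empty there is no distance condition on \<open>H\<close>;
    the bound is then 1, at most \<open>2 * \<alpha>\<close>.\<close>
  then show ?thesis using prob_space.prob_le_1[OF M, of H] \<alpha> by simp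
next
  case False
  interpret prob_space M by fact
  \<comment> \<open>\<open>L\<close> collects the points having some point of \<open>G\<close> at or
    to their right, \<open>R\<close> those having one at or to their left, both restricted to points
    near all of \<open>G\<close>. Then \<open>G\<close> lies in the intersection and
    \<open>H\<close> in the union.\<close>
  define L R where "L = {z. (\<exists>a\<in>G. z \<le> a) \<and> (\<forall>a\<in>G. a - h < z)}"
    "R = {z. (\<exists>a\<in>G. a \<le> z) \<and> (\<forall>a\<in>G. z < a + h)}"
  have "is_interval L"
    unfolding is_interval_1
  proof (intro ballI allI impI)
    fix a b x assume "a \<in> L" "b \<in> L" and x: "a \<le> x \<and> x \<le> b"
    then obtain c where "c \<in> G" "b \<le> c" by (auto simp: L_R_def)
    moreover have "d - h < x" if "d \<in> G" for d
      using \<open>a \<in> L\<close> x that by (fastforce simp: L_R_def)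
    ultimately show "x \<in> L" using x by (auto simp: L_R_def intro!: bexI[of _ c])
  qed
  moreover have "is_interval R"
    unfolding is_interval_1
  proof (intro ballI allI impI)
    fix a b x assume "a \<in> R" "b \<in> R" and x: "a \<le> x \<and> x \<le> b"
    then obtain c where "c \<in> G" "c \<le> a" by (auto simp: L_R_def)
    moreover have "x < d + h" if "d \<in> G" for d
      using \<open>b \<in> R\<close> x that by (fastforce simp: L_R_def)
    ultimately show "x \<in> R" using x by (auto simp: L_R_def intro!: bexI[of _ c])
  qed
  ultimately have m[simp]: "L \<in> sets borel" "R \<in> sets borel"
    by (auto intro: real_interval_borel_measurable)
  have "measure M L \<le> \<alpha>"
  proof (rule measure_short_set_le[OF M S h le m(1)])
    fix y z assume "y \<in> L" "z \<in> L"
    then obtain a where "a \<in> G" "z \<le> a" "a - h < y" by (auto simp: L_R_def)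
    then show "z - y < h" by linarith
  qed
  moreover have "measure M R \<le> \<alpha>"
  proof (rule measure_short_set_le[OF M S h le m(2)])
    fix y z assume "y \<in> R" "z \<in> R"
    then obtain a where "a \<in> G" "a \<le> y" "z < a + h" by (auto simp: L_R_def)
    then show "z - y < h" by linarith
  qed
  moreover have "G \<subseteq> L \<inter> R"
  proof
    fix z assume z: "z \<in> G"
    then have "a - h < z \<and> z < a + h" if "a \<in> G" for a
      using dist[OF that] GH by (force simp: abs_less_iff)
    then show "z \<in> L \<inter> R" using z by (auto simp: L_R_def)
  qed
  then have "measure M G \<le> measure M (L \<inter> R)" by (intro finite_measure_mono) auto
  moreover have "H \<subseteq> L \<union> R"
  proof
    fix z assume "z \<in> H"
    obtain a where "a \<in> G" using False by auto
    have "a' - h < z" "z < a' + h" if "a' \<in> G" for a'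
      using dist[OF that \<open>z \<in> H\<close>] by (auto simp: abs_less_iff)
    then show "z \<in> L \<union> R" using \<open>a \<in> G\<close> linear[of z a] by (auto simp: L_R_def)
  qed
  then have "measure M H \<le> measure M (L \<union> R)" by (intro finite_measure_mono) auto
  moreover have "measure M (L \<union> R) = measure M L + measure M R - measure M (L \<inter> R)"
    by (intro measure_Un3) (auto simp: fmeasurable_eq_sets)
  ultimately show ?thesis by linarith
qed

text \<open>For \<open>w\<close> nonnegative the two indicators contribute \<open>w\<close> and
  \<open>K\<close>. For \<open>w\<close> negative only the second contributes, with length
  \<open>K + w\<close> cut off at 0.\<close>

lemma nn_integral_levels:
  fixes w K :: real
  assumes "w \<le> K" "0 \<le> K"
  shows "(\<integral>\<^sup>+t. indicator {0..K} t * (indicator {t. t < w} t + indicator {t. -t \<le> w} t) \<partial>lborel)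
    = ennreal (K + max (-K) w)"
proof -
  have "(\<integral>\<^sup>+t. indicator {0..K} t * (indicator {t. t < w} t + indicator {t. -t \<le> w} t) \<partial>lborel)
    = (\<integral>\<^sup>+t. indicator {0..<w} t + indicator {max 0 (-w)..K} t \<partial>lborel)"
    using assms by (intro nn_integral_cong) (auto simp: indicator_def)
  also have "\<dots> = emeasure lborel {0..<w} + emeasure lborel {max 0 (-w)..K}"
    by (subst nn_integral_add) auto
  also have "\<dots> = ennreal (max 0 w) + ennreal (if - w \<le> K then K - max 0 (-w) else 0)"
    using assms by (auto simp: max_def)
  also have "\<dots> = ennreal (K + max (-K) w)"
    using assms by (auto simp: max_def simp flip: ennreal_plus)
  finally show ?thesis .
qed

text \<open>Layer cake: every level above \<open>v / 2\<close> is paired with its mirror image below \<open>v / 2\<close>.\<close>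

lemma rearrangement_bound:
  fixes M :: "real measure" and h :: real and \<phi> :: "real \<Rightarrow> real"
  assumes M: "prob_space M" and S[simp, measurable_cong]: "sets M = sets borel" and h: "0 < h" and le: "\<And>x. measure M {x<..x+h} \<le> \<alpha>"
    and \<alpha>: "1/2 \<le> \<alpha>" "\<alpha> \<le> 1"
    and \<phi>[measurable]: "\<phi> \<in> borel_measurable borel" and bound: "\<And>y. 0 \<le> \<phi> y" "\<And>y. \<phi> y \<le> u"
    and pair: "\<And>a b. a + h \<le> b \<Longrightarrow> \<phi> a + \<phi> b \<le> v"
  shows "(\<integral>y. \<phi> y \<partial>M) \<le> (2 * \<alpha> - 1) * u + (1 - \<alpha>) * v"
proof -
  interpret prob_space M by fact
  have int: "integrable M \<phi>"
    by (rule integrable_const_bound[of _ u]) (use bound in auto)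
  \<comment> \<open>\<open>K\<close> bounds the excess of \<open>\<phi>\<close> over
    \<open>v / 2\<close>. If it is negative, the constant bound \<open>u\<close> already
    suffices.\<close>
  define K where "K = u - v / 2"
  show ?thesis
  proof (cases "0 \<le> K")
    case False
    have "(\<integral>y. \<phi> y \<partial>M) \<le> (\<integral>y. u \<partial>M)"
      using int bound by (intro integral_mono) auto
    also have "\<dots> = u" by (simp add: prob_space)
    also have "\<dots> = (2 * \<alpha> - 1) * u + (1 - \<alpha>) * (2 * u)" by (simp add: algebra_simps)
    also have "\<dots> \<le> (2 * \<alpha> - 1) * u + (1 - \<alpha>) * v"
      using False \<alpha> by (intro add_left_mono mult_left_mono) (auto simp: K_def)
    finally show ?thesis .
  next
    case True
    define w where "w y = \<phi> y - v / 2" for y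
    have wK: "w y \<le> K" for y using bound by (simp add: w_def K_def)
    have [measurable]: "w \<in> borel_measurable borel" unfolding w_def by measurable
    define f where "f = (\<lambda>y t. indicator {0..K} t * (indicator {t. t < w y} t + indicator {t. -t \<le> w y} t) :: ennreal)"
    interpret P: pair_sigma_finite M lborel ..
    have f[measurable]: "case_prod f \<in> borel_measurable (M \<Otimes>\<^sub>M lborel)"
      unfolding f_def indicator_def by measurable
    have intw: "integrable M (\<lambda>y. max (-K) (w y))"
      by (rule integrable_const_bound[of _ K]) (use True wK in \<open>auto simp: abs_le_iff max_def\<close>)
    have "ennreal (K + (\<integral>y. max (-K) (w y) \<partial>M)) = ennreal (\<integral>y. K + max (-K) (w y) \<partial>M)"
      using intw by (simp add: prob_space)
    also have "\<dots> = (\<integral>\<^sup>+y. ennreal (K + max (-K) (w y)) \<partial>M)"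
      using intw by (intro nn_integral_eq_integral[symmetric]) auto
    also have "\<dots> = (\<integral>\<^sup>+y. \<integral>\<^sup>+t. f y t \<partial>lborel \<partial>M)"
      using nn_integral_levels[OF wK True] by (simp add: f_def)
    also have "\<dots> = (\<integral>\<^sup>+t. \<integral>\<^sup>+y. f y t \<partial>M \<partial>lborel)"
      by (rule P.Fubini'[symmetric]) (rule f)
    also have "\<dots> \<le> (\<integral>\<^sup>+t. ennreal (2 * \<alpha>) * indicator {0..K} t \<partial>lborel)"
    proof (rule nn_integral_mono)
      fix t :: real
      define G H where "G = {y. t < w y}" "H = {y. -t \<le> w y}"
      have [measurable]: "G \<in> sets borel" "H \<in> sets borel" unfolding G_H_def by measurable
      show "(\<integral>\<^sup>+y. f y t \<partial>M) \<le> ennreal (2 * \<alpha>) * indicator {0..K} t"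
      proof (cases "t \<in> {0..K}")
        case True
        have "(\<integral>\<^sup>+y. f y t \<partial>M) = (\<integral>\<^sup>+y. indicator G y + indicator H y \<partial>M)"
          using True by (intro nn_integral_cong) (auto simp: f_def G_H_def indicator_def)
        also have "\<dots> = emeasure M G + emeasure M H"
          by (subst nn_integral_add) auto
        also have "\<dots> = ennreal (measure M G + measure M H)"
          by (simp add: emeasure_eq_measure)
        also have "\<dots> \<le> ennreal (2 * \<alpha>)"
        proof (intro ennreal_leI measure_opposite_levels_le[OF M S h le \<alpha>(1)])
          show "G \<subseteq> H" using True by (auto simp: G_H_def)
          fix a z assume "a \<in> G" "z \<in> H"
          \<comment> \<open>The level is strict in \<open>G\<close> and weak in \<open>H\<close>, so
            the sum exceeds \<open>v\<close> strictly and \<open>pair\<close> excludes a distance of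
            \<open>h\<close> or more.\<close>
          then have "v < \<phi> a + \<phi> z" by (auto simp: G_H_def w_def)
          then show "\<bar>z - a\<bar> < h" using pair[of a z] pair[of z a] by (force simp: abs_less_iff)
        qed auto
        finally show ?thesis using True by simp
      qed (auto simp: f_def)
    qed
    also have "\<dots> = ennreal (2 * \<alpha> * K)"
      using True \<alpha> by (simp add: nn_integral_cmult_indicator ennreal_mult)
    finally have "K + (\<integral>y. max (-K) (w y) \<partial>M) \<le> 2 * \<alpha> * K"
      using True \<alpha> by (simp add: ennreal_le_iff)
    \<comment> \<open>Truncation from below at \<open>-K\<close> only raises the mean, so the mean
      of \<open>w\<close> is at most \<open>(2 * \<alpha> - 1) * K\<close>.\<close>
    moreover have "(\<integral>y. w y \<partial>M) \<le> (\<integral>y. max (-K) (w y) \<partial>M)"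
      using intw int by (intro integral_mono) (auto simp: w_def)
    moreover have "(\<integral>y. w y \<partial>M) = (\<integral>y. \<phi> y \<partial>M) - v / 2"
      using int by (simp add: w_def prob_space)
    ultimately show ?thesis by (simp add: K_def algebra_simps)
  qed
qed

section \<open>Left endpoints of disjoint intervals, and one convolution step\<close>

definition separated :: "real \<Rightarrow> real set \<Rightarrow> bool" where
  "separated h C \<longleftrightarrow> (\<forall>x\<in>C. \<forall>y\<in>C. x < y \<longrightarrow> x + h \<le> y)"

lemma separated_translate: "separated h C \<Longrightarrow> separated h ((\<lambda>x. x - y) ` C)"
  by (auto simp: separated_def)

text \<open>For \<open>a + h \<le> b\<close> the leftmost interval of the translate by \<open>b\<close> lies to the left of the
  translate by \<open>a\<close> and is moved over to it.\<close>

lemma translate_pair_bound: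
  fixes g F :: "_ \<Rightarrow> real"
  assumes F: "\<And>C. finite C \<Longrightarrow> separated h C \<Longrightarrow> (\<Sum>x\<in>C. g x) \<le> F (card C)"
    and C: "finite C" "separated h C" "C \<noteq> {}" and ab: "a + h \<le> b" "0 < h"
  shows "(\<Sum>x\<in>C. g (x - a)) + (\<Sum>x\<in>C. g (x - b)) \<le> F (card C + 1) + F (card C - 1)"
proof -
  define m where "m = Min C"
  have m: "m \<in> C" "\<And>x. x \<in> C \<Longrightarrow> m \<le> x" using C by (auto simp: m_def)
  \<comment> \<open>The point \<open>m - b\<close> is taken from the translate by \<open>b\<close>
    and given to the translate by \<open>a\<close>. Both sets stay separated and the total sum is
    unchanged.\<close>
  define A where "A = insert (m - b) ((\<lambda>x. x - a) ` C)"
  define B where "B = (\<lambda>x. x - b) ` (C - {m})"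
  have new: "m - b \<notin> (\<lambda>x. x - a) ` C" using m ab by force
  have "separated h A"
    using separated_translate[OF C(2), of a] m ab unfolding A_def separated_def by fastforce
  moreover have "card A = card C + 1"
    using C new by (simp add: A_def card_image inj_on_def)
  moreover have "(\<Sum>x\<in>A. g x) = g (m - b) + (\<Sum>x\<in>C. g (x - a))"
    using C new by (simp add: A_def sum.reindex inj_on_def)
  ultimately have 1: "g (m - b) + (\<Sum>x\<in>C. g (x - a)) \<le> F (card C + 1)"
    using F[of A] C by (simp add: A_def)
  have "separated h B"
    using C(2) unfolding B_def separated_def by auto
  moreover have "card B = card C - 1"
    using C m by (simp add: B_def card_image inj_on_def)
  moreover have "(\<Sum>x\<in>B. g x) = (\<Sum>x\<in>C - {m}. g (x - b))"
    by (simp add: B_def sum.reindex inj_on_def)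
  ultimately have 2: "(\<Sum>x\<in>C - {m}. g (x - b)) \<le> F (card C - 1)"
    using F[of B] C by (simp add: B_def)
  show ?thesis
    using 1 2 C m by (simp add: sum.remove[of C m "\<lambda>x. g (x - b)"])
qed

text \<open>Conditioning on the \<open>M\<close>-variable \<open>y\<close> turns the sum into the
  mean of \<open>\<Sum>x\<in>C. g (x - y)\<close>. This function of \<open>y\<close> is bounded by
  \<open>F (card C)\<close>, and its values at points at least \<open>h\<close> apart by
  \<open>translate_pair_bound\<close>, as \<open>rearrangement_bound\<close> requires.\<close>

lemma convolution_step:
  fixes h :: real
  assumes M: "prob_space M" and N: "prob_space N"
    and [measurable_cong, simp]: "sets M = sets borel" "sets N = sets borel"
    and h: "0 < h" and le: "\<And>x. measure M {x<..x+h} \<le> \<alpha>" and \<alpha>: "1/2 \<le> \<alpha>" "\<alpha> \<le> 1"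
    and F: "\<And>C. finite C \<Longrightarrow> separated h C \<Longrightarrow> (\<Sum>x\<in>C. measure N {x<..x+h}) \<le> F (card C)"
    and C: "finite C" "separated h C" "C \<noteq> {}"
  shows "(\<Sum>x\<in>C. measure (M \<star> N) {x<..x+h})
     \<le> (2 * \<alpha> - 1) * F (card C) + (1 - \<alpha>) * (F (card C + 1) + F (card C - 1))"
proof -
  interpret M: prob_space M by fact
  interpret N: prob_space N by fact
  define g where "g x = measure N {x<..x+h}" for x
  have [measurable]: "g \<in> borel_measurable borel"
  proof -
    \<comment> \<open>Measurability comes from writing \<open>g\<close> as a difference of monotone
      functions.\<close>
    have "g = (\<lambda>x. measure N {..x+h} - measure N {..x})"
    proof
      fix x
      have "{x<..x+h} = {..x+h} - {..x}" by auto
      then show "g x = measure N {..x+h} - measure N {..x}"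
        unfolding g_def using h by (simp add: N.finite_measure_Diff)
    qed
    moreover have "mono (\<lambda>x. measure N {..x})" "mono (\<lambda>x. measure N {..x+h})"
      by (auto intro!: monoI N.finite_measure_mono)
    then have [measurable]: "(\<lambda>x. measure N {..x}) \<in> borel_measurable borel"
      "(\<lambda>x. measure N {..x+h}) \<in> borel_measurable borel"
      by (blast intro: borel_measurable_mono)+
    ultimately show ?thesis by simp
  qed
  have int: "integrable M (\<lambda>y. g (x - y))" for x
  proof (rule M.integrable_const_bound[of _ 1])
    show "(\<lambda>y. g (x - y)) \<in> borel_measurable M" by measurable
  qed (auto simp: g_def)
  have conv: "measure (M \<star> N) {x<..x+h} = (\<integral>y. g (x - y) \<partial>M)" for x
  proof -
    have sp: "space M = UNIV" "space N = UNIV"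
      using sets_eq_imp_space_eq[of M borel] sets_eq_imp_space_eq[of N borel] by auto
    have "emeasure (M \<star> N) {x<..x+h} = (\<integral>\<^sup>+y. emeasure N {a. a + y \<in> {x<..x+h}} \<partial>M)"
      by (intro convolution_emeasure M.finite_measure_axioms N.finite_measure_axioms) (auto simp: sp)
    also have "\<dots> = (\<integral>\<^sup>+y. ennreal (g (x - y)) \<partial>M)"
    proof (rule nn_integral_cong)
      fix y
      have "{a. a + y \<in> {x<..x+h}} = {x - y<..x - y + h}" by auto
      then show "emeasure N {a. a + y \<in> {x<..x+h}} = ennreal (g (x - y))"
        by (simp add: g_def N.emeasure_eq_measure)
    qed
    also have "\<dots> = ennreal (\<integral>y. g (x - y) \<partial>M)"
      using int by (intro nn_integral_eq_integral) (auto simp: g_def)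
    finally show ?thesis
      by (simp add: measure_def g_def)
  qed
  have "(\<Sum>x\<in>C. measure (M \<star> N) {x<..x+h}) = (\<integral>y. (\<Sum>x\<in>C. g (x - y)) \<partial>M)"
    using int by (simp add: conv)
  also have "\<dots> \<le> (2 * \<alpha> - 1) * F (card C) + (1 - \<alpha>) * (F (card C + 1) + F (card C - 1))"
  proof (rule rearrangement_bound[OF M _ h le \<alpha>])
    show "0 \<le> (\<Sum>x\<in>C. g (x - y))" for y by (intro sum_nonneg) (simp add: g_def)
    show "(\<Sum>x\<in>C. g (x - y)) \<le> F (card C)" for y
    proof -
      have "(\<Sum>x\<in>C. g (x - y)) = (\<Sum>x\<in>(\<lambda>x. x - y) ` C. g x)"
        by (simp add: sum.reindex inj_on_def)
      also have "\<dots> \<le> F (card ((\<lambda>x. x - y) ` C))"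
        unfolding g_def using C by (intro F separated_translate) auto
      also have "card ((\<lambda>x. x - y) ` C) = card C" by (simp add: card_image inj_on_def)
      finally show ?thesis .
    qed
    show "(\<Sum>x\<in>C. g (x - a)) + (\<Sum>x\<in>C. g (x - b)) \<le> F (card C + 1) + F (card C - 1)"
      if "a + h \<le> b" for a b
      by (rule translate_pair_bound[OF _ C that h]) (use F in \<open>auto simp: g_def\<close>)
  qed auto
  finally show ?thesis .
qed

section \<open>The extremal lazy walk and its cosine kernel\<close>

text \<open>\<open>kern j t\<close> is the sum of \<open>cos (l * t)\<close> over the integers \<open>-j < l \<le> j\<close>, so
  \<open>walk_bound I p j\<close> below is the probability that a sum of independent steps, \<open>\<plusminus>1\<close> with
  probability \<open>p i / 2\<close> each and 0 otherwise, lands in \<open>{-j<..j}\<close>. By reflection this is also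
  the probability that the walk started at \<open>j\<close> has not hit 0, whence the recurrence.\<close>

definition kern :: "nat \<Rightarrow> real \<Rightarrow> real" where
  "kern j t = (\<Sum>l<j. cos (real l * t) + cos ((real l + 1) * t))"

lemma continuous_on_kern [continuous_intros]: "continuous_on A (kern j)"
  unfolding kern_def by (intro continuous_intros)

lemma kern_Suc: "kern (Suc j) t = kern j t + cos (real j * t) + cos ((real j + 1) * t)"
  by (simp add: kern_def)

lemma kern_recurrence: "kern (Suc (Suc j)) t + kern j t = 2 * cos t * kern (Suc j) t"
proof (induction j)
  case 0
  show ?case using cos_double_cos[of t] by (simp add: kern_def algebra_simps power2_eq_square)
next
  case (Suc j)
  have c: "2 * cos t * cos x = cos (x + t) + cos (x - t)" for x
    by (simp add: cos_add cos_diff)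
  have k: "kern (Suc (Suc j)) t = kern (Suc j) t + cos ((real j + 1) * t) + cos ((real j + 2) * t)"
    "kern (Suc (Suc (Suc j))) t = kern (Suc (Suc j)) t + cos ((real j + 2) * t) + cos ((real j + 3) * t)"
    "kern (Suc j) t = kern j t + cos (real j * t) + cos ((real j + 1) * t)"
    by (simp_all only: kern_Suc[of "Suc j"] kern_Suc[of "Suc (Suc j)"] kern_Suc[of j] of_nat_Suc) (simp_all add: add.commute)
  have "2 * cos t * kern (Suc (Suc j)) t
      = 2 * cos t * kern (Suc j) t + 2 * cos t * cos ((real j + 1) * t) + 2 * cos t * cos ((real j + 2) * t)"
    unfolding k(1) by (simp add: distrib_left)
  moreover have "2 * cos t * cos ((real j + 1) * t) = cos ((real j + 2) * t) + cos (real j * t)"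
    unfolding c by (simp add: algebra_simps)
  moreover have "2 * cos t * cos ((real j + 2) * t) = cos ((real j + 3) * t) + cos ((real j + 1) * t)"
    unfolding c by (simp add: algebra_simps)
  ultimately show ?case using Suc k by linarith
qed

lemma integral_cos_multiple: "((\<lambda>t. cos (real l * t)) has_integral (if l = 0 then pi else 0)) {0..pi}"
proof (cases "l = 0")
  case True
  then show ?thesis using has_integral_const_real[of "1::real" 0 pi] by simp
next
  case False
  have "((\<lambda>t. cos (real l * t)) has_integral (sin (real l * pi) / l - sin (real l * 0) / l)) {0..pi}"
    using False
    by (intro fundamental_theorem_of_calculus)
       (auto intro!: derivative_eq_intros simp flip: has_real_derivative_iff_has_vector_derivative)
  then show ?thesis using False by simp
qed

lemma integral_kern: "integral {0..pi} (kern j) = (if j = 0 then 0 else pi)"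
proof -
  have "(kern j has_integral (\<Sum>l<j. (if l = 0 then pi else 0) + (if Suc l = 0 then pi else 0))) {0..pi}"
    unfolding kern_def
    using has_integral_add[OF integral_cos_multiple integral_cos_multiple[of "Suc l" for l]]
    by (intro has_integral_sum) (auto simp: add.commute)
  moreover have "(\<Sum>l<j. (if l = 0 then pi else 0) + (if Suc l = 0 then pi else 0)) = (if j = 0 then 0 else pi)"
    by (cases j) (simp_all add: sum.lessThan_Suc_shift)
  ultimately show ?thesis by (simp add: integral_unique)
qed

definition walk_bound :: "'i set \<Rightarrow> ('i \<Rightarrow> real) \<Rightarrow> nat \<Rightarrow> real" where
  "walk_bound I p j = integral {0..pi} (\<lambda>t. kern j t * (\<Prod>i\<in>I. 1 - p i * (1 - cos t))) / pi"

lemma walk_bound_insert: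
  assumes "finite I" "i \<notin> I" "0 < j"
  shows "walk_bound (insert i I) p j
    = (1 - p i) * walk_bound I p j + p i / 2 * (walk_bound I p (j + 1) + walk_bound I p (j - 1))"
proof -
  define A where "A t = (\<Prod>i\<in>I. 1 - p i * (1 - cos t))" for t
  have int: "(\<lambda>t. kern j t * A t) integrable_on {0..pi}" for j
    unfolding A_def by (intro integrable_continuous_real continuous_intros)
  obtain k where j: "j = Suc k" using assms by (cases j) auto
  have "kern j t * ((1 - p i * (1 - cos t)) * A t)
     = (1 - p i) * (kern j t * A t) + p i / 2 * (kern (j + 1) t * A t + kern (j - 1) t * A t)" for t
  proof -
    have "kern (j + 1) t * A t + kern (j - 1) t * A t = 2 * cos t * kern j t * A t"
      using kern_recurrence[of k t] by (simp add: j flip: distrib_right)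
    then show ?thesis by (simp add: algebra_simps)
  qed
  then have "integral {0..pi} (\<lambda>t. kern j t * (\<Prod>i\<in>insert i I. 1 - p i * (1 - cos t)))
    = integral {0..pi} (\<lambda>t. (1 - p i) * (kern j t * A t) + p i / 2 * (kern (j + 1) t * A t + kern (j - 1) t * A t))"
    using assms by (simp add: A_def)
  also have "\<dots> = (1 - p i) * integral {0..pi} (\<lambda>t. kern j t * A t)
     + p i / 2 * (integral {0..pi} (\<lambda>t. kern (j + 1) t * A t) + integral {0..pi} (\<lambda>t. kern (j - 1) t * A t))"
    by (simp add: Henstock_Kurzweil_Integration.integral_add int integrable_add integrable_on_mult_right)
  finally show ?thesis
    unfolding walk_bound_def A_def[symmetric] by (simp add: add_divide_distrib distrib_left)
qed

text \<open>Adding a variable gives \<open>convolution_step\<close> on one side and the same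
  recurrence, \<open>walk_bound_insert\<close>, on the other. The step involves cardinalities one
  higher and one lower, so the induction runs over all separated families at once.\<close>

lemma (in prob_space) sum_intervals_le_walk_bound:
  fixes h :: real and X :: "'i \<Rightarrow> 'a \<Rightarrow> real"
  assumes h: "0 < h" and I: "finite I" and indep: "indep_vars (\<lambda>_. borel) X I"
    and \<alpha>: "\<And>i. i \<in> I \<Longrightarrow> 1/2 \<le> \<alpha> i \<and> \<alpha> i \<le> 1"
    and le: "\<And>i x. i \<in> I \<Longrightarrow> measure (distr M borel (X i)) {x<..x+h} \<le> \<alpha> i"
    and C: "finite C" "separated h C"
  shows "(\<Sum>x\<in>C. measure (distr M borel (\<lambda>\<omega>. \<Sum>i\<in>I. X i \<omega>)) {x<..x+h})
     \<le> walk_bound I (\<lambda>i. 2 * (1 - \<alpha> i)) (card C)"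
  using I indep \<alpha> le C
proof (induction I arbitrary: C rule: finite_induct)
  case empty
  \<comment> \<open>The empty sum is 0, and at most one of the disjoint intervals contains
    it.\<close>
  have "(\<Sum>x\<in>C. measure (distr M borel (\<lambda>\<omega>. \<Sum>i\<in>{}. X i \<omega>)) {x<..x+h}) = (\<Sum>x\<in>C. indicator {x<..x+h} (0::real))"
    by (intro sum.cong) (auto simp: measure_return)
  also have "\<dots> \<le> (if card C = 0 then 0 else 1)"
  proof (cases "\<exists>x\<in>C. 0 \<in> {x<..x+h}")
    case True
    then obtain x where x: "x \<in> C" "0 \<in> {x<..x+h}" by blast
    have "(\<Sum>y\<in>C. indicator {y<..y+h} (0::real)) = (\<Sum>y\<in>C. if y = x then 1 else 0 :: real)"
    proof (rule sum.cong)
      fix y assume y: "y \<in> C"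
      show "indicator {y<..y+h} (0::real) = (if y = x then 1 else 0 :: real)"
        using y x empty(5) linorder_less_linear[of x y] unfolding separated_def by (force simp: indicator_def)
    qed simp
    also have "\<dots> = 1" using x empty by simp
    finally show ?thesis using x empty by auto
  next
    case False
    then have "(\<Sum>x\<in>C. indicator {x<..x+h} (0::real)) = (0::real)" by (intro sum.neutral) auto
    then show ?thesis by simp
  qed
  also have "\<dots> = walk_bound {} (\<lambda>i. 2 * (1 - \<alpha> i)) (card C)"
    by (simp add: walk_bound_def integral_kern)
  finally show ?case .
next
  case (insert i I)
  have rv: "random_variable borel (X j)" if "j \<in> insert i I" for j
    using insert.prems(1) that by (auto simp: indep_vars_def)
  define S where "S \<omega> = (\<Sum>j\<in>I. X j \<omega>)" for \<omega>
  have [measurable]: "X i \<in> borel_measurable M" "S \<in> borel_measurable M"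
    unfolding S_def using rv by auto
  have "indep_var borel (X i) borel S"
    unfolding S_def using insert by (intro indep_vars_sum) auto
  then have eq: "distr M borel (\<lambda>\<omega>. \<Sum>j\<in>insert i I. X j \<omega>) = (distr M borel (X i) \<star> distr M borel S)"
    using sum_indep_random_variable[of "X i" S] insert.hyps by (simp add: S_def)
  show ?case
  \<comment> \<open>The empty family is split off because \<open>card C - 1\<close> is truncated at
    0; there both sides vanish.\<close>
  proof (cases "C = {}")
    case True
    then show ?thesis by (simp add: walk_bound_def kern_def)
  next
    case False
    have "(\<Sum>x\<in>C. measure (distr M borel (\<lambda>\<omega>. \<Sum>j\<in>insert i I. X j \<omega>)) {x<..x+h})
      \<le> (2 * \<alpha> i - 1) * walk_bound I (\<lambda>i. 2 * (1 - \<alpha> i)) (card C)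
        + (1 - \<alpha> i) * (walk_bound I (\<lambda>i. 2 * (1 - \<alpha> i)) (card C + 1) + walk_bound I (\<lambda>i. 2 * (1 - \<alpha> i)) (card C - 1))"
      unfolding eq
    proof (rule convolution_step[OF _ _ _ _ h])
      fix D :: "real set" assume "finite D" "separated h D"
      then show "(\<Sum>x\<in>D. measure (distr M borel S) {x<..x+h}) \<le> walk_bound I (\<lambda>i. 2 * (1 - \<alpha> i)) (card D)"
        unfolding S_def using insert.prems
        by (intro insert.IH) (auto intro: indep_vars_subset)
    qed (use insert.prems False in \<open>auto intro: prob_space_distr\<close>)
    also have "\<dots> = walk_bound (insert i I) (\<lambda>i. 2 * (1 - \<alpha> i)) (card C)"
      using insert.hyps insert.prems False by (simp add: walk_bound_insert card_gt_0_iff)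
    finally show ?thesis .
  qed
qed

section \<open>The difference of two Poisson variables\<close>

lemma expectation_power_poisson0:
  fixes z :: complex
  assumes r: "0 \<le> r" and z: "norm z \<le> 1"
  shows "(\<integral>k. z ^ k \<partial>measure_pmf (poisson0_pmf r)) = exp (of_real r * (z - 1))"
proof (cases "r = 0")
  case True
  then show ?thesis by (simp add: poisson0_pmf_def integral_return)
next
  case False
  then have r: "0 < r" using r by simp
  have "(\<lambda>k. (of_real r * z) ^ k /\<^sub>R fact k) sums exp (of_real r * z)"
    by (rule exp_converges)
  from sums_mult[OF this, of "exp (- of_real r)"]
  have sums: "(\<lambda>k. pmf (poisson_pmf r) k *\<^sub>R z ^ k) sums exp (of_real r * (z - 1))"
    using r by (simp add: scaleR_conv_of_real power_mult_distrib field_simps exp_of_real exp_diff exp_minus)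
  have int: "integrable (measure_pmf (poisson_pmf r)) (\<lambda>k. z ^ k)"
    by (rule measure_pmf.integrable_const_bound[of _ 1]) (auto simp: norm_power power_le_one z)
  then have int': "integrable (count_space UNIV) (\<lambda>k. pmf (poisson_pmf r) k *\<^sub>R z ^ k)"
    by (subst (asm) measure_pmf_eq_density, subst (asm) integrable_density) auto
  have "(\<integral>k. z ^ k \<partial>measure_pmf (poisson_pmf r)) = (\<integral>k. pmf (poisson_pmf r) k *\<^sub>R z ^ k \<partial>count_space UNIV)"
    by (subst measure_pmf_eq_density, subst integral_density) auto
  also have "\<dots> = (\<Sum>k. pmf (poisson_pmf r) k *\<^sub>R z ^ k)"
    using int' by (rule integral_count_space_nat)
  also have "\<dots> = exp (of_real r * (z - 1))"
    using sums by (simp add: sums_iff)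
  finally show ?thesis using False by (simp add: poisson0_pmf_def)
qed

lemma integral_cos_int_multiple: "integral {0..pi} (\<lambda>t. cos (of_int k * t)) = (if k = 0 then pi else 0)"
proof -
  have "cos (of_int k * t) = cos (real (nat \<bar>k\<bar>) * t)" for t :: real
    by (cases "0 \<le> k") auto
  then show ?thesis using integral_unique[OF integral_cos_multiple[of "nat \<bar>k\<bar>"]] by simp
qed

lemma integral_restrict_lborel:
  fixes f :: "real \<Rightarrow> real"
  assumes "continuous_on {a..b} f"
  shows "(\<integral>t. f t \<partial>restrict_space lborel {a..b}) = integral {a..b} f"
proof -
  have "(\<integral>t. f t \<partial>restrict_space lborel {a..b}) = (LINT t:{a..b}|lborel. f t)"
    by (simp add: integral_restrict_space set_lebesgue_integral_def)
  also have "\<dots> = integral {a..b} f"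
    by (rule set_borel_integral_eq_integral(2)) (rule borel_integrable_atLeastAtMost'[OF assms])
  finally show ?thesis .
qed

text \<open>Fourier inversion on the integers: integrating
  \<open>cos (d * t) + cos ((d - 1) * t)\<close> over \<open>{0..pi}\<close> gives pi for
  \<open>d\<close> in \<open>{0, 1}\<close> and 0 for other integers. Fubini reduces the claim to
  the generating functions at \<open>cis t\<close> and \<open>cis (-t)\<close>.\<close>

lemma (in prob_space) prob_poisson_difference:
  assumes r: "0 \<le> r" and p1: "poisson_distributed M r \<eta>1" and p2: "poisson_distributed M r \<eta>2"
    and indep: "indep_var (count_space UNIV) \<eta>1 (count_space UNIV) \<eta>2"
  shows "prob {\<omega> \<in> space M. int (\<eta>1 \<omega>) - int (\<eta>2 \<omega>) \<in> {0, 1}}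
     = integral {0..pi} (\<lambda>t. (1 + cos t) * exp (- (2 * r * (1 - cos t)))) / pi"
proof -
  have [measurable]: "\<eta>1 \<in> measurable M (count_space UNIV)" "\<eta>2 \<in> measurable M (count_space UNIV)"
    using p1 p2 by (auto simp: poisson_distributed_def)
  define D where "D \<omega> = int (\<eta>1 \<omega>) - int (\<eta>2 \<omega>)" for \<omega>
  define f :: "'a \<Rightarrow> real \<Rightarrow> real" where "f = (\<lambda>\<omega> t. cos (of_int (D \<omega>) * t) + cos (of_int (D \<omega> - 1) * t))"
  have [measurable]: "(\<lambda>\<omega>. real_of_int (D \<omega>)) \<in> borel_measurable M"
    unfolding D_def by simp
  have expect: "(\<integral>\<omega>. f \<omega> t \<partial>M) = (1 + cos t) * exp (- (2 * r * (1 - cos t)))" for t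
  proof -
    let ?u = "\<lambda>\<omega>. cis t ^ \<eta>1 \<omega>" and ?v = "\<lambda>\<omega>. cis (-t) ^ \<eta>2 \<omega>"
    have ind: "indep_var borel ?u borel ?v"
      using indep_var_compose[OF indep, of "\<lambda>k. cis t ^ k" borel "\<lambda>k. cis (-t) ^ k" borel]
      by (simp add: comp_def)
    have iu: "integrable M ?u" "integrable M ?v"
      by (rule integrable_const_bound[of _ 1]; simp add: norm_power)+
    have e: "(\<integral>\<omega>. z ^ \<eta> \<omega> \<partial>M) = exp (of_real r * (z - 1))"
      if "poisson_distributed M r \<eta>" "norm z \<le> 1" for \<eta> and z :: complex
    proof -
      have "(\<integral>\<omega>. z ^ \<eta> \<omega> \<partial>M) = (\<integral>k. z ^ k \<partial>distr M (count_space UNIV) \<eta>)"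
        using that by (intro integral_distr[symmetric]) (auto simp: poisson_distributed_def)
      also have "\<dots> = exp (of_real r * (z - 1))"
        using that r expectation_power_poisson0[of r z] by (simp add: poisson_distributed_def)
      finally show ?thesis .
    qed
    have "f \<omega> t = Re (?u \<omega> * ?v \<omega> * (1 + cis (-t)))" for \<omega>
    proof -
      have "?u \<omega> * ?v \<omega> = cis (of_int (D \<omega>) * t)"
        unfolding Complex.DeMoivre cis_mult by (simp add: D_def algebra_simps)
      moreover have "cis (of_int (D \<omega>) * t) * cis (-t) = cis (of_int (D \<omega> - 1) * t)"
        unfolding cis_mult by (simp add: algebra_simps)
      ultimately have "?u \<omega> * ?v \<omega> * (1 + cis (-t)) = cis (of_int (D \<omega>) * t) + cis (of_int (D \<omega> - 1) * t)"
        by (simp only: distrib_left mult_1_right)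
      then show ?thesis by (simp add: f_def)
    qed
    then have "(\<integral>\<omega>. f \<omega> t \<partial>M) = (\<integral>\<omega>. Re (?u \<omega> * ?v \<omega> * (1 + cis (-t))) \<partial>M)" by simp
    also have "\<dots> = Re (\<integral>\<omega>. ?u \<omega> * ?v \<omega> * (1 + cis (-t)) \<partial>M)"
      using indep_var_integrable[OF ind iu] by (intro integral_Re) auto
    also have "(\<integral>\<omega>. ?u \<omega> * ?v \<omega> * (1 + cis (-t)) \<partial>M) = (\<integral>\<omega>. ?u \<omega> \<partial>M) * (\<integral>\<omega>. ?v \<omega> \<partial>M) * (1 + cis (-t))"
      using indep_var_integrable[OF ind iu] indep_var_lebesgue_integral[OF ind iu] by simp
    also have "\<dots> = exp (of_real r * (cis t - 1) + of_real r * (cis (-t) - 1)) * (1 + cis (-t))"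
      using e[OF p1, of "cis t"] e[OF p2, of "cis (-t)"] by (simp add: exp_add)
    also have "of_real r * (cis t - 1) + of_real r * (cis (-t) - 1) = complex_of_real (- (2 * r * (1 - cos t)))"
      by (simp add: complex_eq_iff algebra_simps)
    finally show ?thesis unfolding exp_of_real by (simp add: mult.commute)
  qed
  let ?L = "restrict_space lborel {0..pi}"
  interpret L: finite_measure ?L
    by (rule finite_measureI) (simp add: space_restrict_space emeasure_restrict_space)
  interpret P: pair_sigma_finite M ?L ..
  interpret PF: finite_measure "M \<Otimes>\<^sub>M ?L"
    by (intro finite_measure_pair_measure) unfold_locales
  have meas[measurable]: "case_prod f \<in> borel_measurable (M \<Otimes>\<^sub>M ?L)"
  proof -
    have [measurable]: "(\<lambda>t. t) \<in> borel_measurable ?L" by (rule measurable_restrict_space1) simp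
    show ?thesis unfolding f_def of_int_diff by measurable
  qed
  have "integrable (M \<Otimes>\<^sub>M ?L) (case_prod f)"
  proof (rule PF.integrable_const_bound[of _ 2])
    have "\<bar>f \<omega> t\<bar> \<le> 2" for \<omega> t
      unfolding f_def using abs_cos_le_one[of "of_int (D \<omega>) * t"] abs_cos_le_one[of "of_int (D \<omega> - 1) * t"] by linarith
    then show "AE x in M \<Otimes>\<^sub>M ?L. norm (case_prod f x) \<le> 2" by (auto simp: case_prod_beta)
  qed (rule meas)
  from P.Fubini_integral[OF this]
  have fub: "(\<integral>t. (\<integral>\<omega>. f \<omega> t \<partial>M) \<partial>?L) = (\<integral>\<omega>. (\<integral>t. f \<omega> t \<partial>?L) \<partial>M)" .
  have "(\<integral>t. f \<omega> t \<partial>?L) = pi * indicator {\<omega> \<in> space M. D \<omega> \<in> {0, 1}} \<omega>" if "\<omega> \<in> space M" for \<omega>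
  proof -
    have "(\<integral>t. f \<omega> t \<partial>?L) = integral {0..pi} (\<lambda>t. f \<omega> t)"
      unfolding f_def by (intro integral_restrict_lborel continuous_intros)
    also have "\<dots> = integral {0..pi} (\<lambda>t. cos (of_int (D \<omega>) * t)) + integral {0..pi} (\<lambda>t. cos (of_int (D \<omega> - 1) * t))"
      unfolding f_def
      by (intro Henstock_Kurzweil_Integration.integral_add integrable_continuous_real continuous_intros)
    also have "\<dots> = pi * indicator {\<omega> \<in> space M. D \<omega> \<in> {0, 1}} \<omega>"
      unfolding integral_cos_int_multiple using that by (auto simp: indicator_def)
    finally show ?thesis .
  qed
  then have "(\<integral>\<omega>. (\<integral>t. f \<omega> t \<partial>?L) \<partial>M) = (\<integral>\<omega>. pi * indicator {\<omega> \<in> space M. D \<omega> \<in> {0, 1}} \<omega> \<partial>M)"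
    by (rule Bochner_Integration.integral_cong[OF refl])
  also have "\<dots> = pi * prob {\<omega> \<in> space M. D \<omega> \<in> {0, 1}}"
    by (simp add: Int_absorb2 subset_iff)
  finally have "pi * prob {\<omega> \<in> space M. D \<omega> \<in> {0, 1}} = (\<integral>t. (1 + cos t) * exp (- (2 * r * (1 - cos t))) \<partial>?L)"
    using fub by (simp add: expect)
  also have "\<dots> = integral {0..pi} (\<lambda>t. (1 + cos t) * exp (- (2 * r * (1 - cos t))))"
    by (intro integral_restrict_lborel continuous_intros)
  finally show ?thesis by (simp add: D_def field_simps)
qed

section \<open>Gaussian bound for the Poisson integral\<close>

lemma integral_gaussian_le: "integral {0..b} (\<lambda>x::real. exp (- x\<^sup>2)) \<le> sqrt pi / 2"
proof -
  have s: "set_integrable lborel {0..b} (\<lambda>x::real. exp (- x\<^sup>2))"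
    by (intro borel_integrable_atLeastAtMost' continuous_intros)
  have "integral {0..b} (\<lambda>x::real. exp (- x\<^sup>2)) = (LINT x:{0..b}|lborel. exp (- x\<^sup>2))"
    by (rule set_borel_integral_eq_integral(2)[OF s, symmetric])
  also have "\<dots> \<le> (\<integral>x. indicator {0..} x *\<^sub>R exp (- x\<^sup>2) \<partial>lborel)"
    unfolding set_lebesgue_integral_def
    using s has_bochner_integral_integrable gaussian_moment_0
    by (intro integral_mono) (auto simp: set_integrable_def indicator_def has_bochner_integral_iff)
  also have "\<dots> = sqrt pi / 2"
    by (rule has_bochner_integral_integral_eq[OF gaussian_moment_0])
  finally show ?thesis .
qed

text \<open>In half angles the exponent is \<open>- (g t)\<^sup>2\<close>, and
  \<open>1 + cos t\<close> is at most \<open>2 * cos (t / 2)\<close>, a constant multiple of the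
  derivative of \<open>g\<close>. Substitution leaves a piece of the half-line Gaussian
  integral.\<close>

lemma integral_poisson_kernel_le:
  fixes r :: real
  assumes r: "0 < r"
  shows "integral {0..pi} (\<lambda>t. (1 + cos t) * exp (- (2 * r * (1 - cos t)))) / pi \<le> sqrt (2 / (pi * r))"
proof -
  define g where "g t = 2 * sqrt r * sin (t / 2)" for t
  have half: "1 - cos t = 2 * (sin (t / 2))\<^sup>2" "1 + cos t = 2 * (cos (t / 2))\<^sup>2" for t :: real
    using cos_double_sin[of "t / 2"] cos_double_cos[of "t / 2"] by auto
  have "((\<lambda>t. (sqrt r * cos (t / 2)) *\<^sub>R exp (- (g t)\<^sup>2)) has_integral
      integral {g 0..g pi} (\<lambda>x. exp (- x\<^sup>2))) {0..pi}"
  proof (rule has_integral_substitution[where c = 0 and d = "2 * sqrt r"])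
    show "g ` {0..pi} \<subseteq> {0..2 * sqrt r}"
    proof clarsimp
      fix t :: real assume "0 \<le> t" "t \<le> pi"
      then have "0 \<le> sin (t / 2)" by (intro sin_ge_zero) auto
      then show "0 \<le> g t \<and> g t \<le> 2 * sqrt r"
        using r mult_left_mono[of "sin (t / 2)" 1 "2 * sqrt r"] by (auto simp: g_def)
    qed
    show "(g has_real_derivative sqrt r * cos (t / 2)) (at t within {0..pi})" for t
      unfolding g_def by (auto intro!: derivative_eq_intros)
  qed (use r in \<open>auto intro!: continuous_intros simp: g_def\<close>)
  then have sub: "((\<lambda>t. 2 / sqrt r * (sqrt r * cos (t / 2) * exp (- (g t)\<^sup>2))) has_integral
      2 / sqrt r * integral {g 0..g pi} (\<lambda>x. exp (- x\<^sup>2))) {0..pi}"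
    by (intro has_integral_mult_right) simp
  have "integral {0..pi} (\<lambda>t. (1 + cos t) * exp (- (2 * r * (1 - cos t))))
      \<le> integral {0..pi} (\<lambda>t. 2 / sqrt r * (sqrt r * cos (t / 2) * exp (- (g t)\<^sup>2)))"
  proof (rule integral_le)
    fix t :: real assume "t \<in> {0..pi}"
    then have c: "0 \<le> cos (t / 2)" by (intro cos_ge_zero) auto
    have "(g t)\<^sup>2 = 2 * r * (1 - cos t)"
      using r by (simp add: g_def half power_mult_distrib)
    moreover have "1 + cos t \<le> 2 * cos (t / 2)"
      unfolding half using mult_left_mono[OF cos_le_one[of "t / 2"] c] by (simp add: power2_eq_square)
    ultimately show "(1 + cos t) * exp (- (2 * r * (1 - cos t)))
        \<le> 2 / sqrt r * (sqrt r * cos (t / 2) * exp (- (g t)\<^sup>2))"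
      using r by simp
  qed (use sub in \<open>auto intro!: integrable_continuous_real continuous_intros simp: has_integral_integrable\<close>)
  also have "\<dots> = 2 / sqrt r * integral {g 0..g pi} (\<lambda>x. exp (- x\<^sup>2))"
    by (rule integral_unique[OF sub])
  also have "\<dots> \<le> 2 / sqrt r * (sqrt pi / 2)"
    using r integral_gaussian_le[of "g pi"] by (intro mult_left_mono) (auto simp: g_def)
  also have "\<dots> = pi * sqrt (1 / (pi * r))"
    using r by (simp add: real_sqrt_divide real_sqrt_mult field_simps)
  \<comment> \<open>The argument yields \<open>sqrt (1 / (pi * r))\<close>, relaxed here by a factor
    \<open>sqrt 2\<close>.\<close>
  also have "\<dots> \<le> pi * sqrt (2 / (pi * r))"
    using r by (intro mult_left_mono real_sqrt_le_mono divide_right_mono) auto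
  finally show ?thesis by (simp add: field_simps)
qed

theorem corollary1p4:
  fixes n :: nat and \<alpha> :: "nat \<Rightarrow> real" and lam :: real
    and M :: "'a measure" and X :: "nat \<Rightarrow> 'a \<Rightarrow> real"
    and N :: "'b measure" and \<eta>1 \<eta>2 :: "'b \<Rightarrow> nat"
  assumes n: "n \<ge> 1"
    and alpha: "\<And>i. i \<in> {1..n} \<Longrightarrow> \<alpha> i \<in> {1/2..1}"
    and M: "prob_space M"
    and indep_X: "prob_space.indep_vars M (\<lambda>_. borel) X {1..n}"
    and conc_X: "\<And>i. i \<in> {1..n} \<Longrightarrow> concentration M 2 (X i) \<le> \<alpha> i"
    and lam: "lam = (\<Sum>i=1..n. 1 - \<alpha> i)"
    and N: "prob_space N"
    and poisson1: "poisson_distributed N lam \<eta>1"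
    and poisson2: "poisson_distributed N lam \<eta>2"
    and indep_eta: "prob_space.indep_var N (count_space UNIV) \<eta>1 (count_space UNIV) \<eta>2"
  shows "concentration M 2 (\<lambda>\<omega>. \<Sum>i=1..n. X i \<omega>)
           \<le> measure N {\<omega> \<in> space N. int (\<eta>1 \<omega>) - int (\<eta>2 \<omega>) \<in> {0, 1}}
       \<and> ereal (measure N {\<omega> \<in> space N. int (\<eta>1 \<omega>) - int (\<eta>2 \<omega>) \<in> {0, 1}})
           \<le> (if lam = 0 then \<infinity> else ereal (sqrt (2 / (pi * lam))))"
proof
  interpret M: prob_space M by (rule M)
  interpret N: prob_space N by (rule N)
  define p where "p i = 2 * (1 - \<alpha> i)" for i
  have p: "0 \<le> p i \<and> p i \<le> 1" if "i \<in> {1..n}" for i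
    using alpha[OF that] by (auto simp: p_def)
  have sum_p: "sum p {1..n} = 2 * lam"
    unfolding p_def lam by (rule sum_distrib_left[symmetric])
  have lam0: "0 \<le> lam"
    unfolding lam using alpha by (intro sum_nonneg) auto
  have rv: "X i \<in> borel_measurable M" if "i \<in> {1..n}" for i
    using indep_X that by (auto simp: M.indep_vars_def)
  have distr: "measure (distr M borel Y) {x<..x + 2} = measure M {\<omega> \<in> space M. Y \<omega> \<in> {x<..x + 2}}"
    if "Y \<in> borel_measurable M" for Y :: "'a \<Rightarrow> real" and x
    using that by (subst measure_distr) (auto intro!: arg_cong[where f = M.prob])
  have interval: "measure (distr M borel (X i)) {x<..x + 2} \<le> \<alpha> i" if i: "i \<in> {1..n}" for i x
  proof -
    have "measure M {\<omega> \<in> space M. X i \<omega> \<in> {x<..x + 2}} \<le> concentration M 2 (X i)"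
      unfolding concentration_def by (intro cSUP_upper bdd_aboveI[of _ 1]) auto
    then show ?thesis using conc_X[OF i] distr[OF rv[OF i]] by simp
  qed
  define J where "J = integral {0..pi} (\<lambda>t. (1 + cos t) * exp (- (2 * lam * (1 - cos t)))) / pi"
  have J: "measure N {\<omega> \<in> space N. int (\<eta>1 \<omega>) - int (\<eta>2 \<omega>) \<in> {0, 1}} = J"
    unfolding J_def by (rule N.prob_poisson_difference[OF lam0 poisson1 poisson2 indep_eta])
  have "concentration M 2 (\<lambda>\<omega>. \<Sum>i=1..n. X i \<omega>) \<le> J"
    unfolding concentration_def
  proof (rule cSUP_least)
    \<comment> \<open>A single interval is the separated family \<open>{x}\<close>, and
      \<open>kern 1 t\<close> is \<open>1 + cos t\<close>.\<close>
    fix x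
    have "measure M {\<omega> \<in> space M. (\<Sum>i=1..n. X i \<omega>) \<in> {x<..x + 2}}
        = (\<Sum>x\<in>{x}. measure (distr M borel (\<lambda>\<omega>. \<Sum>i=1..n. X i \<omega>)) {x<..x + 2})"
      using distr[of "\<lambda>\<omega>. \<Sum>i=1..n. X i \<omega>" x] rv by simp
    also have "\<dots> \<le> walk_bound {1..n} (\<lambda>i. 2 * (1 - \<alpha> i)) (card {x})"
      by (rule M.sum_intervals_le_walk_bound[OF _ _ indep_X])
         (use alpha interval in \<open>auto simp: separated_def\<close>)
    also have "\<dots> = integral {0..pi} (\<lambda>t. (1 + cos t) * (\<Prod>i\<in>{1..n}. 1 - p i * (1 - cos t))) / pi"
      by (simp add: walk_bound_def kern_def p_def)
    also have "\<dots> \<le> J"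
      unfolding J_def sum_p[symmetric]
      by (intro divide_right_mono integral_prod_cos_le_exp) (use p in auto)
    finally show "measure M {\<omega> \<in> space M. (\<Sum>i=1..n. X i \<omega>) \<in> {x<..x + 2}} \<le> J" .
  qed simp
  then show "concentration M 2 (\<lambda>\<omega>. \<Sum>i=1..n. X i \<omega>)
      \<le> measure N {\<omega> \<in> space N. int (\<eta>1 \<omega>) - int (\<eta>2 \<omega>) \<in> {0, 1}}"
    unfolding J .
  show "ereal (measure N {\<omega> \<in> space N. int (\<eta>1 \<omega>) - int (\<eta>2 \<omega>) \<in> {0, 1}})
      \<le> (if lam = 0 then \<infinity> else ereal (sqrt (2 / (pi * lam))))"
    unfolding J using integral_poisson_kernel_le[of lam] lam0 by (auto simp: J_def)
qed

end
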